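(* Let $p$ be an odd prime, $q=p^e$, and let $k,l\ge 3$ be coprime to $p$ with $(k,l)$ hyperbolic, i.e. $1/k+1/l<1/2$. Let $\xi_\kappa,\xi_\lambda$ be primitive $2k$-th and $2l$-th roots of unity in $GF(q)$ or $GF(q^2)$, let $\omega_\kappa=\xi_\kappa+\xi_\kappa^{-1}$, $\omega_\lambda=\xi_\lambda+\xi_\lambda^{-1}$, and $D=\omega_\kappa^2+\omega_\lambda^2-4$. Consider the regular map of type $(k,l)$ given by the generating triple $(X,Y,Z)$ of matrices determined by $\xi_\kappa,\xi_\lambda$ described in the context, where $G=\langle X,Y,Z\rangle$ is isomorphic to $PSL(2,q)$ or $PGL(2,q)$. Then the map is self-Petrie-dual if and only if one of the following conditions is fulfilled: 1. $\omega_\lambda^2=-D$; 2. $q=r^2=p^{2j}$ for some positive integer $j$ (with $r=p^j$), $\omega_\lambda^{2r}=-D$, and $k$ divides $r+1$ or $r-1$.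
   Context: A regular map of type $(k,l)$ (vertex degree $k$, face length $l$) is identified with a group $G$ generated by three involutions $X,Y,Z$ such that $XY$, $YZ$, $ZX$ have orders exactly $2,k,l$ respectively. The map is self-Petrie-dual if $G$ has an (involutory) automorphism fixing $Y$ and $Z$ and interchanging $X$ and $XY$. Matrices are regarded up to nonzero scalar multiples, i.e. as elements of $PGL(2,K)$ with $K$ an algebraic closure of $GF(p)$. For $k,l$ coprime to $p$, with $D=\omega_\kappa^2+\omega_\lambda^2-4$ (assumed nonzero), $\beta=-1/\sqrt{-D}$, $\eta=(\xi_\kappa-\xi_\kappa^{-1})^{-1}$, the generating triple is $$X=\eta\beta\begin{pmatrix} D & D\omega_\lambda\xi_\kappa\\ -\omega_\lambda\xi_\kappa^{-1} & -D\end{pmatrix},\quad Y=\beta\begin{pmatrix}0&\xi_\kappa D\\ \xi_\kappa^{-1}&0\end{pmatrix},\quad Z=\beta\begin{pmatrix}0&D\\1&0\end{pmatrix}.$$ *)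

theory Defs
  imports
    "HOL-Analysis.Analysis"
    "HOL-Algebra.Generated_Groups"
    "HOL-Algebra.Multiplicative_Group"
    "HOL-Computational_Algebra.Computational_Algebra"
begin

text \<open>
  The whole type \<open>'a\<close> is an algebraic closure of \<open>GF(p)\<close>.  In characteristic \<open>p\<close>, the set
  \<open>\<int> = range of_int\<close> is the prime field \<open>GF(p)\<close> inside \<open>'a\<close>.
\<close>

definition algebraic_closure_GF :: "'a :: alg_closed_field itself \<Rightarrow> nat \<Rightarrow> bool" where
  "algebraic_closure_GF _ p \<longleftrightarrow>
     CHAR('a) = p \<and>
     (\<forall>x :: 'a. \<exists>P. P \<noteq> 0 \<and> (\<forall>i. Polynomial.coeff P i \<in> \<int>) \<and> poly P x = 0)"

text \<open>For \<open>q\<close> a power of \<open>p\<close> greater than 1, this is the unique subfield with \<open>q\<close> elements.\<close>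

definition GF :: "nat \<Rightarrow> 'a :: alg_closed_field set" where
  "GF q = {x. x ^ q = x}"

definition primitive_root_of_unity :: "nat \<Rightarrow> 'a :: field \<Rightarrow> bool" where
  "primitive_root_of_unity n x \<longleftrightarrow> n > 0 \<and> x ^ n = 1 \<and> (\<forall>m. 0 < m \<and> m < n \<longrightarrow> x ^ m \<noteq> 1)"


text \<open>
  In the following groups \<open>F\<close> is a subfield of the ambient field, given as a set.
  \<open>mat c\<close> is the scalar matrix with diagonal entries \<open>c\<close>.
\<close>

definition GL2 :: "'a :: field set \<Rightarrow> ('a ^ 2 ^ 2) monoid" where
  "GL2 F = \<lparr>carrier = {A. (\<forall>i j. A $ i $ j \<in> F) \<and> det A \<noteq> 0}, mult = (**), one = mat 1\<rparr>"

definition SL2 :: "'a :: field set \<Rightarrow> ('a ^ 2 ^ 2) monoid" where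
  "SL2 F = \<lparr>carrier = {A. (\<forall>i j. A $ i $ j \<in> F) \<and> det A = 1}, mult = (**), one = mat 1\<rparr>"

definition PGL2 :: "'a :: field set \<Rightarrow> ('a ^ 2 ^ 2) set monoid" where
  "PGL2 F = GL2 F Mod {mat c | c. c \<in> F \<and> c \<noteq> 0}"

definition PSL2 :: "'a :: field set \<Rightarrow> ('a ^ 2 ^ 2) set monoid" where
  "PSL2 F = SL2 F Mod {mat 1, mat (- 1)}"

text \<open>The element of \<open>PGL(2,K)\<close> represented by a matrix, where \<open>K\<close> is the whole type.\<close>

definition proj :: "'a :: field ^ 2 ^ 2 \<Rightarrow> ('a ^ 2 ^ 2) set" where
  "proj A = {mat c | c. c \<noteq> 0} #>\<^bsub>GL2 UNIV\<^esub> A"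

definition mat2 :: "'a :: field \<Rightarrow> 'a \<Rightarrow> 'a \<Rightarrow> 'a \<Rightarrow> 'a ^ 2 ^ 2" where
  "mat2 a b c d = vector [vector [a, b], vector [c, d]]"


definition regular_map :: "nat \<Rightarrow> nat \<Rightarrow> ('g, 'm) monoid_scheme \<Rightarrow> 'g \<Rightarrow> 'g \<Rightarrow> 'g \<Rightarrow> bool" where
  "regular_map k l G X Y Z \<longleftrightarrow>
     group G \<and> {X, Y, Z} \<subseteq> carrier G \<and> carrier G = generate G {X, Y, Z} \<and>
     group.ord G X = 2 \<and> group.ord G Y = 2 \<and> group.ord G Z = 2 \<and>
     group.ord G (X \<otimes>\<^bsub>G\<^esub> Y) = 2 \<and>
     group.ord G (Y \<otimes>\<^bsub>G\<^esub> Z) = k \<and>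
     group.ord G (Z \<otimes>\<^bsub>G\<^esub> X) = l"

definition self_Petrie_dual :: "('g, 'm) monoid_scheme \<Rightarrow> 'g \<Rightarrow> 'g \<Rightarrow> 'g \<Rightarrow> bool" where
  "self_Petrie_dual G X Y Z \<longleftrightarrow>
     (\<exists>\<phi> \<in> iso G G.
        (\<forall>g \<in> carrier G. \<phi> (\<phi> g) = g) \<and>
        \<phi> Y = Y \<and> \<phi> Z = Z \<and> \<phi> X = X \<otimes>\<^bsub>G\<^esub> Y \<and> \<phi> (X \<otimes>\<^bsub>G\<^esub> Y) = X)"

end

theory Submission
  imports Defs
begin

text \<open>
  The function \<open>\<tau> = tr\<^sup>2 / det\<close> on \<open>PGL(2, K)\<close> is invariant under conjugation. Any homomorphism from
  \<open>SL(2, q)\<close> or \<open>GL(2, q)\<close> to \<open>PGL(2, K)\<close> whose kernel consists of the scalars is, up to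
  conjugation, a power of the Frobenius map applied to the entries: a unipotent element stays
  unipotent, the Weyl element can be normalized together with it, and the map \<open>f\<close> that is then
  induced on \<open>u(x) = [1, x; 0, 1]\<close> is additive and commutes with inversion, hence a field
  automorphism. So an automorphism of \<open>G\<close> transforms \<open>\<tau>\<close> by some \<open>x \<mapsto> x\<^bsup>p^j\<^esup>\<close>, and if it is an
  involution, then \<open>j = 0\<close> or \<open>2 j = e\<close>. A self-Petrie-duality fixes \<open>Y Z\<close>, where
  \<open>\<tau> = \<omega>\<^sub>k\<^sup>2\<close>, and takes \<open>Z X\<close>, where \<open>\<tau> = \<omega>\<^sub>l\<^sup>2\<close>, to \<open>Z X Y\<close>, where \<open>\<tau> = - D\<close>; this gives
  the two conditions. Conversely, under these conditions a diagonal or antidiagonal matrix \<open>C\<close>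
  can be written down such that \<open>A \<mapsto> C A\<^bsup>(r)\<^esup> C\<^sup>-\<^sup>1\<close> is the required automorphism.
\<close>

section \<open>Finite fields\<close>

locale finite_subfield =
  fixes F :: "'a :: field set"
  assumes finite: "finite F"
    and zero: "0 \<in> F"
    and one: "1 \<in> F"
    and add: "x \<in> F \<Longrightarrow> y \<in> F \<Longrightarrow> x + y \<in> F"
    and mult: "x \<in> F \<Longrightarrow> y \<in> F \<Longrightarrow> x * y \<in> F"
    and uminus: "x \<in> F \<Longrightarrow> - x \<in> F"
    and inverse: "x \<in> F \<Longrightarrow> inverse x \<in> F"
begin

lemma diff: "x \<in> F \<Longrightarrow> y \<in> F \<Longrightarrow> x - y \<in> F"
  using add[of x "- y"] uminus by simp

lemma divide: "x \<in> F \<Longrightarrow> y \<in> F \<Longrightarrow> x / y \<in> F"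
  using mult[of x "inverse y"] inverse by (simp add: field_simps)

lemma power: "x \<in> F \<Longrightarrow> x ^ n \<in> F"
  by (induction n) (auto simp: one mult)

lemma of_nat: "of_nat n \<in> F"
  by (induction n) (auto simp: zero one add)

text \<open>The unit group of a finite field is cyclic. That theorem is stated for fields given as
  ring records, so \<open>F\<close> is repackaged as the record \<open>R\<close>.\<close>

lemma exists_generator: "\<exists>g\<in>F. g \<noteq> 0 \<and> (\<forall>x\<in>F - {0}. \<exists>n. x = g ^ n)"
proof -
  define R where "R = \<lparr>carrier = F, monoid.mult = ((*) :: 'a \<Rightarrow> _), one = 1, zero = 0, add = ((+) :: 'a \<Rightarrow> _)\<rparr>"
  have R: "field R"
  proof (rule cring.cring_fieldI2)
    show "cring R"
    proof (rule cringI)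
      show "abelian_group R"
      proof (rule abelian_groupI)
        fix x assume "x \<in> carrier R"
        then show "\<exists>y\<in>carrier R. y \<oplus>\<^bsub>R\<^esub> x = \<zero>\<^bsub>R\<^esub>"
          by (intro bexI[of _ "- x"]) (auto simp: R_def uminus)
      qed (auto simp: R_def add zero algebra_simps)
      show "comm_monoid R"
        by unfold_locales (auto simp: R_def mult one algebra_simps)
    qed (auto simp: R_def algebra_simps)
    show "\<zero>\<^bsub>R\<^esub> \<noteq> \<one>\<^bsub>R\<^esub>" by (simp add: R_def)
    fix x assume "x \<in> carrier R" "x \<noteq> \<zero>\<^bsub>R\<^esub>"
    then show "\<exists>y\<in>carrier R. x \<otimes>\<^bsub>R\<^esub> y = \<one>\<^bsub>R\<^esub>"
      by (intro bexI[of _ "inverse x"]) (auto simp: R_def inverse)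
  qed
  have "x [^]\<^bsub>R\<^esub> n = x ^ n" for x and n :: nat
    by (induction n) (auto simp: R_def)
  moreover obtain g where "g \<in> carrier (mult_of R)"
    "carrier (mult_of R) = {g [^]\<^bsub>R\<^esub> i | i :: nat. i \<in> UNIV}"
    using field.finite_field_mult_group_has_gen[OF R] finite by (auto simp: R_def)
  ultimately show ?thesis
    by (intro bexI[of _ g]) (auto simp: R_def)
qed

text \<open>Multiplication by \<open>x\<close> permutes the nonzero elements, so their product
  absorbs the factor \<open>x ^ card (F - {0})\<close>.\<close>

lemma power_card_eq_1:
  assumes "x \<in> F" "x \<noteq> 0"
  shows "x ^ card (F - {0}) = 1"
proof -
  have "bij_betw ((*) x) (F - {0}) (F - {0})"
    by (rule bij_betw_byWitness[where f' = "\<lambda>y. y / x"])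
       (use assms in \<open>auto simp: mult divide\<close>)
  then have "(\<Prod>y\<in>F - {0}. x * y) = (\<Prod>y\<in>F - {0}. y)"
    by (rule prod.reindex_bij_betw)
  then have "x ^ card (F - {0}) * (\<Prod>y\<in>F - {0}. y) = (\<Prod>y\<in>F - {0}. y)"
    by (simp add: prod.distrib)
  moreover have "(\<Prod>y\<in>F - {0}. y) \<noteq> 0"
    using finite by auto
  ultimately show ?thesis by simp
qed

end

lemma poly_zero_if_many_roots:
  fixes P :: "'a :: idom poly"
  assumes "finite F" "\<And>x. x \<in> F \<Longrightarrow> poly P x = 0" "degree P < card F"
  shows "P = 0"
proof (rule ccontr)
  assume "P \<noteq> 0"
  then have "card F \<le> card {x. poly P x = 0}"
    by (intro card_mono poly_roots_finite) (use assms in auto)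
  also have "\<dots> \<le> degree P"
    using \<open>P \<noteq> 0\<close> by (rule card_poly_roots_bound)
  finally show False using assms by simp
qed

text \<open>Write n = p^i m with p not dividing m. By Frobenius, (1 + X)^n = (1 + X^(p^i))^m, whose
  coefficient at X^(p^i) is m, nonzero in characteristic p. In 1 + X^n this coefficient vanishes
  unless m = 1.\<close>

lemma exponent_power_of_char_if_additive:
  fixes n :: nat
  assumes "prime CHAR('a :: idom)" "n > 0"
    and additive: "([:1, 1:] :: 'a poly) ^ n = 1 + Polynomial.monom 1 n"
  shows "\<exists>i. n = CHAR('a) ^ i"
proof -
  define p where "p = CHAR('a)"
  obtain m i where n: "n = p ^ i * m" "\<not> p dvd m"
    using assms multiplicity_decompose'[of n p] p_def
    by (metis mult.commute not_prime_unit gr_implies_not0)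
  have "m = 1"
  proof (rule ccontr)
    assume "m \<noteq> 1"
    then have m: "m > 1" using assms n by (cases m) auto
    have pi: "p ^ i > 0" using assms by (simp add: p_def prime_gt_0_nat)
    have CP: "CHAR('a poly) = p" by (simp add: p_def)
    have "([:1, 1:] :: 'a poly) = 1 + Polynomial.monom 1 1"
      by (simp add: monom_Suc one_pCons)
    then have "([:1, 1:] :: 'a poly) ^ (p ^ i) = 1 + Polynomial.monom 1 (p ^ i)"
      using freshmans_dream'[of "p ^ i" i "1 :: 'a poly" "Polynomial.monom 1 1"] assms(1) CP
      by (simp add: p_def monom_power)
    then have "([:1, 1:] :: 'a poly) ^ n = (Polynomial.monom 1 (p ^ i) + 1) ^ m"
      unfolding n by (simp add: power_mult add.commute)
    also have "\<dots> = (\<Sum>k\<le>m. of_nat (m choose k) * Polynomial.monom 1 (p ^ i * k))"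
      by (subst binomial_ring) (simp add: monom_power mult.commute)
    finally have "Polynomial.coeff ([:1, 1:] ^ n :: 'a poly) (p ^ i)
        = (\<Sum>k\<le>m. of_nat (m choose k) * (if p ^ i * k = p ^ i then 1 else 0))"
      by (simp add: coeff_sum of_nat_poly)
    also have "\<dots> = (\<Sum>k\<le>m. if k = 1 then of_nat (m choose k) else 0)"
      using pi by (intro sum.cong) auto
    also have "\<dots> = of_nat m"
      using m by (simp add: sum.delta)
    finally have "(of_nat m :: 'a) = Polynomial.coeff (1 + Polynomial.monom 1 n) (p ^ i)"
      using additive by simp
    also have "\<dots> = 0"
      using m pi n by (auto simp: coeff_1)
    finally show False
      using n by (simp add: of_nat_eq_0_iff_char_dvd p_def)
  qed
  then show ?thesis using n p_def by auto
qed

context finite_subfield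
begin

text \<open>The unit group is cyclic, so \<open>f\<close> is a power map \<open>x \<mapsto> x\<^sup>n\<close> with \<open>n < card F\<close>; additivity then
  forces the polynomial identity \<open>(1 + X)\<^sup>n = 1 + X\<^sup>n\<close>.\<close>

lemma endomorphism_is_Frobenius:
  assumes "prime CHAR('a)"
    and f1: "f 1 = 1"
    and f_closed: "\<And>x. x \<in> F \<Longrightarrow> f x \<in> F"
    and f_add: "\<And>x y. x \<in> F \<Longrightarrow> y \<in> F \<Longrightarrow> f (x + y) = f x + f y"
    and f_mult: "\<And>x y. x \<in> F \<Longrightarrow> y \<in> F \<Longrightarrow> f (x * y) = f x * f y"
  shows "\<exists>i. \<forall>x\<in>F. f x = x ^ (CHAR('a) ^ i)"
proof -
  obtain g where g: "g \<in> F" "g \<noteq> 0" "\<And>x. x \<in> F \<Longrightarrow> x \<noteq> 0 \<Longrightarrow> \<exists>n. x = g ^ n"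
    using exists_generator by auto
  have f0: "f 0 = 0" using f_add[OF zero zero] by (metis add.right_neutral add_left_cancel)
  have "f g * f (inverse g) = 1"
    using f_mult[of g "inverse g"] g inverse f1 by simp
  then have "f g \<noteq> 0" by auto
  then obtain m where m: "f g = g ^ m" using g f_closed by blast
  define N where "N = card (F - {0})"
  have "N > 0" unfolding N_def using finite one by (auto simp: card_gt_0_iff)
  have cardF: "card F = Suc N"
    unfolding N_def using finite zero by (metis card.remove)
  \<comment> \<open>The exponent only matters modulo \<open>N\<close>. The residue 0 is replaced by
    \<open>N\<close>, since a zeroth power would not send 0 to 0; \<open>n \<le> N\<close> keeps the
    degree of \<open>P\<close> below \<open>card F\<close>.\<close>
  define n where "n = (if m mod N = 0 then N else m mod N)"
  have n: "n > 0" "n \<le> N" using \<open>N > 0\<close> by (auto simp: n_def less_imp_le)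
  have "g ^ N = 1" using power_card_eq_1 g by (simp add: N_def)
  have "g ^ m = g ^ (m mod N) * (g ^ N) ^ (m div N)"
    by (simp flip: power_mult power_add)
  then have gn: "f g = g ^ n" using \<open>g ^ N = 1\<close> m by (simp add: n_def)
  have f_power: "f (x ^ k) = f x ^ k" if "x \<in> F" for x k
    by (induction k) (use that in \<open>auto simp: f1 f_mult power\<close>)
  have fn: "f x = x ^ n" if "x \<in> F" for x
  proof (cases "x = 0")
    case False
    with \<open>x \<in> F\<close> obtain k where "x = g ^ k" using g by blast
    then show ?thesis using f_power[of g k] g gn by (simp add: mult.commute flip: power_mult)
  qed (use f0 n in simp)
  define P :: "'a poly" where "P = [:1, 1:] ^ n - 1 - Polynomial.monom 1 n"
  have "P = 0"
  proof (rule poly_zero_if_many_roots)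
    show "finite F" by (fact finite)
    show "poly P x = 0" if "x \<in> F" for x
      using f_add[of 1 x] fn[of x] fn[of "1 + x"] f1 that one add
      by (simp add: P_def poly_monom)
    have "degree P \<le> n"
      unfolding P_def
      by (intro degree_diff_le) (auto simp: degree_power_eq degree_monom_le)
    then show "degree P < card F" using cardF n by simp
  qed
  then have "([:1, 1:] :: 'a poly) ^ n = 1 + Polynomial.monom 1 n"
    by (simp add: P_def algebra_simps)
  then obtain i where "n = CHAR('a) ^ i"
    using exponent_power_of_char_if_additive assms(1) n by blast
  then show ?thesis using fn by blast
qed

end

section \<open>The field with q elements inside the algebraic closure\<close>

text \<open>\<open>GF q\<close> is the root set of X^q - X: it is closed under addition by
  Frobenius, and it has exactly q elements because the derivative -1 rules out multiple
  roots.\<close>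

lemma
  fixes p e q :: nat
  assumes "prime p" "CHAR('a :: alg_closed_field) = p" "e \<ge> 1" "q = p ^ e"
  shows finite_subfield_GF: "finite_subfield (GF q :: 'a set)"
    and card_GF: "card (GF q :: 'a set) = q"
proof -
  define P :: "'a poly" where "P = Polynomial.monom 1 q - Polynomial.monom 1 1"
  have q: "q > 1" using assms by (simp only: prime_gt_1_nat one_less_power)
  have "degree (Polynomial.monom (- 1) 1 :: 'a poly) < degree (Polynomial.monom 1 q :: 'a poly)"
    using q by (simp add: degree_monom_eq)
  then have degP: "degree P = q"
    unfolding P_def diff_conv_add_uminus minus_monom
    by (simp add: degree_add_eq_left degree_monom_eq)
  then have "P \<noteq> 0" using q by auto
  have GF: "GF q = {x :: 'a. poly P x = 0}"
    by (simp add: GF_def P_def poly_monom)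
  then have fin: "finite (GF q :: 'a set)" using \<open>P \<noteq> 0\<close> poly_roots_finite by auto
  have add: "(x + y) ^ q = x ^ q + y ^ q" for x y :: 'a
    using freshmans_dream'[of q e x y] assms by simp
  have minus: "(- x) ^ q = - (x ^ q)" for x :: 'a
    using add[of x "- x"] q by (simp add: power_0_left add_eq_0_iff)
  show "finite_subfield (GF q :: 'a set)"
    by unfold_locales (use fin q in \<open>auto simp: GF_def power_0_left add minus power_mult_distrib power_inverse\<close>)
  have "(of_nat q :: 'a) = 0"
    using assms by (simp add: of_nat_eq_0_iff_char_dvd)
  then have pd: "pderiv P = - 1"
    by (simp add: P_def pderiv_diff pderiv_monom one_pCons monom_0)
  have order: "Polynomial.order a P = 1" if "poly P a = 0" for a
  proof -
    have "Polynomial.order a P \<noteq> 0" using that \<open>P \<noteq> 0\<close> order_root by auto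
    moreover have "\<not> Polynomial.order a P \<ge> 2"
    proof
      assume "Polynomial.order a P \<ge> 2"
      then have "[:- a, 1:] ^ 2 dvd P"
        using order_divides by blast
      then obtain Q where "P = [:- a, 1:] ^ 2 * Q" by (rule dvdE)
      then have "P = [:- a, 1:] * ([:- a, 1:] * Q)"
        by (simp only: power2_eq_square mult.assoc)
      then have "poly (pderiv P) a = 0"
        by (simp only: pderiv_mult) simp
      then show False using pd by simp
    qed
    ultimately show ?thesis by linarith
  qed
  \<comment> \<open>Over an algebraically closed field \<open>P\<close> splits, so its multiset of
    roots has size \<open>degree P\<close>, that is \<open>q\<close>. As every root has order 1,
    this counts distinct roots.\<close>
  obtain A where A: "size A = degree P" "P = Polynomial.smult (lead_coeff P) (\<Prod>x\<in>#A. [:- x, 1:])"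
    using alg_closed_imp_factorization \<open>P \<noteq> 0\<close> by blast
  have "proots (\<Prod>x\<in>#B. [:- x, 1:]) = B" for B :: "'a multiset"
  proof (induction B)
    case (add x B)
    have "(\<Prod>x\<in>#B. [:- x, 1:]) \<noteq> (0 :: 'a poly)"
      by (auto simp: prod_mset_zero_iff)
    then have "proots ([:- x, 1:] * (\<Prod>x\<in>#B. [:- x, 1:])) = add_mset x B"
      by (subst proots_mult) (simp_all add: add.IH)
    then show ?case by (simp del: mult_pCons_left)
  qed simp
  then have "proots P = A"
    by (subst A(2)) (use \<open>P \<noteq> 0\<close> in simp)
  then have "size (proots P) = q" using A degP by simp
  moreover have "size (proots P) = (\<Sum>x\<in>(GF q :: 'a set). 1)"
    unfolding size_multiset_overloaded_eq
    by (rule sum.cong) (use \<open>P \<noteq> 0\<close> order in \<open>auto simp: GF\<close>)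
  ultimately show "card (GF q :: 'a set) = q"
    by simp
qed

section \<open>Two-by-two matrices up to scalars\<close>

lemma mat2_nth [simp]:
  "mat2 a b c d $ 1 $ 1 = a" "mat2 a b c d $ 1 $ 2 = b"
  "mat2 a b c d $ 2 $ 1 = c" "mat2 a b c d $ 2 $ 2 = d"
  by (simp_all add: mat2_def)

lemma mat2_eq_iff [simp]:
  "mat2 a b c d = mat2 a' b' c' d' \<longleftrightarrow> a = a' \<and> b = b' \<and> c = c' \<and> d = d'"
  by (metis mat2_nth)

lemma mat2_eta: "(A :: 'a :: field ^ 2 ^ 2) = mat2 (A $ 1 $ 1) (A $ 1 $ 2) (A $ 2 $ 1) (A $ 2 $ 2)"
  by (simp add: vec_eq_iff forall_2)

lemma mat2_exhaust: obtains a b c d where "(A :: 'a :: field ^ 2 ^ 2) = mat2 a b c d"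
  using mat2_eta by blast

lemma mat2_mult [simp]:
  "mat2 a b c d ** mat2 a' b' c' d' =
     mat2 (a * a' + b * c') (a * b' + b * d') (c * a' + d * c') (c * b' + d * d')"
  by (simp add: vec_eq_iff forall_2 matrix_matrix_mult_def sum_2)

lemma mat_eq_mat2: "mat c = mat2 c 0 0 c"
  by (simp add: vec_eq_iff forall_2 mat_def)

lemma det_mat2 [simp]: "det (mat2 a b c d) = a * d - b * c"
  by (simp add: det_2)

lemma det_mat_2 [simp]: "det (mat c :: 'a :: field ^ 2 ^ 2) = c\<^sup>2"
  by (simp add: mat_eq_mat2 power2_eq_square)

lemma mat_mult_mat: "mat c ** mat d = (mat (c * d) :: 'a :: field ^ 2 ^ 2)"
  by (simp add: mat_eq_mat2)

lemma mat_mult_commute: "mat c ** A = (A :: 'a :: field ^ 2 ^ 2) ** (mat c :: 'a :: field ^ 2 ^ 2)"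
  by (cases A rule: mat2_exhaust) (simp add: mat_eq_mat2 mult.commute)

text \<open>The adjugate replaces the inverse: up to the scalar \<open>det A\<close> they agree, and
  conjugation then needs no division.\<close>

definition adj :: "'a :: field ^ 2 ^ 2 \<Rightarrow> 'a ^ 2 ^ 2" where
  "adj A = mat2 (A $ 2 $ 2) (- A $ 1 $ 2) (- A $ 2 $ 1) (A $ 1 $ 1)"

lemma adj_mat2 [simp]: "adj (mat2 a b c d) = mat2 d (- b) (- c) a"
  by (simp add: adj_def)

lemma adj_mult: "A ** adj A = mat (det A)" "adj A ** A = mat (det A)"
  by (cases A rule: mat2_exhaust; simp add: mat_eq_mat2 algebra_simps)+

lemma det_adj [simp]: "det (adj A) = det A"
  by (cases A rule: mat2_exhaust) (simp add: algebra_simps)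

text \<open>The zero matrix counts as scalar; where this matters, a nonzero determinant excludes
  it.\<close>

definition scalar :: "'a :: field ^ 2 ^ 2 \<Rightarrow> bool" where
  "scalar A \<longleftrightarrow> (\<exists>c. A = mat c)"

lemma scalar_mat [simp]: "scalar (mat c)"
  by (auto simp: scalar_def)

lemma scalar_mat2 [simp]: "scalar (mat2 a b c d) \<longleftrightarrow> b = 0 \<and> c = 0 \<and> a = d"
  by (auto simp: scalar_def mat_eq_mat2)

definition \<tau> :: "'a :: field ^ 2 ^ 2 \<Rightarrow> 'a" where
  "\<tau> A = (A $ 1 $ 1 + A $ 2 $ 2)\<^sup>2 / det A"

lemma \<tau>_mat2 [simp]: "\<tau> (mat2 a b c d) = (a + d)\<^sup>2 / (a * d - b * c)"
  by (simp add: \<tau>_def)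

definition map_mat :: "('a \<Rightarrow> 'a) \<Rightarrow> 'a :: field ^ 2 ^ 2 \<Rightarrow> 'a ^ 2 ^ 2" where
  "map_mat f A = mat2 (f (A $ 1 $ 1)) (f (A $ 1 $ 2)) (f (A $ 2 $ 1)) (f (A $ 2 $ 2))"

lemma map_mat_mat2 [simp]: "map_mat f (mat2 a b c d) = mat2 (f a) (f b) (f c) (f d)"
  by (simp add: map_mat_def)

text \<open>For invertible matrices this is equality in PGL(2, K). Working with representatives lets
  products be computed entrywise before passing to cosets.\<close>

definition peq :: "'a :: field ^ 2 ^ 2 \<Rightarrow> 'a ^ 2 ^ 2 \<Rightarrow> bool"  (infix "\<propto>" 50) where
  "A \<propto> B \<longleftrightarrow> (\<exists>c. c \<noteq> 0 \<and> A = mat c ** B)"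

lemma peqI: "c \<noteq> 0 \<Longrightarrow> A = mat c ** B \<Longrightarrow> A \<propto> B"
  by (auto simp: peq_def)

lemma peq_refl [simp, intro]: "A \<propto> A"
  by (rule peqI[of 1]) auto

lemma peq_sym: "A \<propto> B \<Longrightarrow> B \<propto> A"
proof -
  assume "A \<propto> B"
  then obtain c where "c \<noteq> 0" "A = mat c ** B" by (auto simp: peq_def)
  then show ?thesis
    by (intro peqI[of "1 / c"]) (simp_all add: matrix_mul_assoc mat_mult_mat)
qed

lemma peq_trans [trans]: "A \<propto> B \<Longrightarrow> B \<propto> C \<Longrightarrow> A \<propto> C"
proof -
  assume "A \<propto> B" "B \<propto> C"
  then obtain c d where "c \<noteq> 0" "A = mat c ** B" "d \<noteq> 0" "B = mat d ** C"
    by (auto simp: peq_def)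
  then show ?thesis
    by (intro peqI[of "c * d"]) (simp_all add: matrix_mul_assoc mat_mult_mat)
qed

lemma peq_mult: "A \<propto> B \<Longrightarrow> C \<propto> D \<Longrightarrow> A ** C \<propto> B ** D"
proof -
  assume "A \<propto> B" "C \<propto> D"
  then obtain c d where "c \<noteq> 0" "A = mat c ** B" "d \<noteq> 0" "C = mat d ** D"
    by (auto simp: peq_def)
  then show ?thesis
    by (intro peqI[of "c * d"])
       (simp_all add: mat_mult_commute[of d B] matrix_mul_assoc flip: mat_mult_mat,
        simp add: mat_mult_commute[of d B] flip: matrix_mul_assoc)
qed

lemma mat_mult_peq: "c \<noteq> 0 \<Longrightarrow> mat c ** A \<propto> A"
  by (rule peqI) auto

lemma peq_\<tau>: "A \<propto> B \<Longrightarrow> \<tau> A = \<tau> B"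
proof -
  assume "A \<propto> B"
  then obtain c where c: "c \<noteq> 0" "A = mat c ** B" by (auto simp: peq_def)
  have "A $ 1 $ 1 + A $ 2 $ 2 = c * (B $ 1 $ 1 + B $ 2 $ 2)"
    unfolding c by (cases B rule: mat2_exhaust) (simp add: mat_eq_mat2 distrib_left)
  moreover have "det A = c\<^sup>2 * det B"
    unfolding c by (simp add: det_mul)
  ultimately show ?thesis
    unfolding \<tau>_def using c(1) by (simp add: power_mult_distrib)
qed

lemma peq_scalar: "A \<propto> B \<Longrightarrow> scalar A \<longleftrightarrow> scalar B"
  by (cases B rule: mat2_exhaust) (auto simp: peq_def mat_eq_mat2)

lemma peq_cancel_left:
  assumes "det A \<noteq> 0" "A ** B \<propto> A ** C"
  shows "B \<propto> C"
proof -
  have "adj A ** (A ** D) \<propto> D" for D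
    using assms(1) by (simp add: matrix_mul_assoc adj_mult mat_mult_peq)
  then show ?thesis
    using peq_mult[OF peq_refl[of "adj A"] assms(2)] by (meson peq_sym peq_trans)
qed

text \<open>Using \<open>adj C\<close> for the inverse scales the trace by \<open>det C\<close> and
  the determinant by its square, and the two cancel in \<open>\<tau>\<close>.\<close>

lemma \<tau>_conj:
  assumes "det C \<noteq> 0"
  shows "\<tau> (C ** A ** adj C) = \<tau> A"
proof -
  obtain a b c d where A: "A = mat2 a b c d" by (rule mat2_exhaust)
  obtain a' b' c' d' where C: "C = mat2 a' b' c' d'" by (rule mat2_exhaust)
  have det: "det (C ** A ** adj C) = (det C)\<^sup>2 * det A"
    by (simp add: det_mul power2_eq_square)
  have "(C ** A ** adj C) $ 1 $ 1 + (C ** A ** adj C) $ 2 $ 2 = det C * (A $ 1 $ 1 + A $ 2 $ 2)"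
    by (simp add: A C algebra_simps)
  then show ?thesis
    unfolding \<tau>_def det using assms by (simp add: power_mult_distrib)
qed

subsection \<open>The group \<open>PGL(2, K)\<close>\<close>

text \<open>Leaving \<open>S\<close> abstract covers GL(2, K), SL(2, q) and GL(2, q) at once. The
  scalars are normal because they are central.\<close>

lemma
  fixes S :: "('a :: field ^ 2 ^ 2) set"
  assumes one: "mat 1 \<in> S"
    and mult: "\<And>A B. A \<in> S \<Longrightarrow> B \<in> S \<Longrightarrow> A ** B \<in> S"
    and inverse: "\<And>A. A \<in> S \<Longrightarrow> \<exists>B\<in>S. B ** A = mat 1"
    and M: "M = \<lparr>carrier = S, mult = (**), one = mat 1\<rparr>"
    and N: "N = {A \<in> S. scalar A}"
  shows matrix_group: "group M"
    and scalars_normal: "N \<lhd> M"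
proof -
  show M_group: "group M"
    by (rule groupI) (use assms in \<open>auto simp: matrix_mul_assoc\<close>)
  interpret M: group M by (fact M_group)
  have commute: "A ** B = B ** A" if "A \<in> N" for A B
    using that by (auto simp: N scalar_def mat_mult_commute)
  have "subgroup N M"
  proof (rule M.subgroupI)
    show "N \<subseteq> carrier M" "N \<noteq> {}" using one by (auto simp: M N)
  next
    fix A assume A: "A \<in> N"
    then obtain B where B: "B \<in> S" "B ** A = mat 1" using inverse by (auto simp: N)
    have inv: "inv\<^bsub>M\<^esub> A = B"
      by (rule M.inv_equality) (use A B in \<open>auto simp: M N\<close>)
    obtain c where c: "A = mat c" using A by (auto simp: N scalar_def)
    obtain b1 b2 b3 b4 where B2: "B = mat2 b1 b2 b3 b4" by (rule mat2_exhaust)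
    have "b1 * c = b4 * c" "c \<noteq> 0" "scalar B \<longleftrightarrow> b1 = b4"
      using B(2) by (auto simp: c B2 mat_eq_mat2)
    then have "scalar B" by simp
    then show "inv\<^bsub>M\<^esub> A \<in> N" using inv B by (simp add: N)
  next
    fix A B assume "A \<in> N" "B \<in> N"
    then show "A \<otimes>\<^bsub>M\<^esub> B \<in> N" by (auto simp: M N mult scalar_def mat_mult_mat)
  qed
  then show "N \<lhd> M"
    by (rule M.normalI) (use commute in \<open>auto simp: r_coset_def l_coset_def M\<close>)
qed

lemma scalars_normal_GL2_UNIV:
  "{mat c | c. c \<in> UNIV \<and> c \<noteq> 0} \<lhd> GL2 (UNIV :: 'a :: field set)"
proof -
  define S where "S = {A :: 'a ^ 2 ^ 2. det A \<noteq> 0}"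
  have 1: "mat 1 \<in> S" by (simp add: S_def)
  have 2: "A ** B \<in> S" if "A \<in> S" "B \<in> S" for A B using that by (simp add: S_def det_mul)
  have 3: "\<exists>B\<in>S. B ** A = mat 1" if "A \<in> S" for A
    by (rule bexI[of _ "mat (1 / det A) ** adj A"])
       (use that in \<open>simp_all add: S_def det_mul adj_mult mat_mult_mat flip: matrix_mul_assoc\<close>)
  have 4: "GL2 (UNIV :: 'a set) = \<lparr>carrier = S, mult = (**), one = mat 1\<rparr>"
    by (simp add: GL2_def S_def)
  have 5: "{mat c | c. c \<in> UNIV \<and> c \<noteq> 0} = {A \<in> S. scalar A}"
    by (auto simp: S_def scalar_def)
  show ?thesis by (rule scalars_normal[OF 1 2 3 4 5])
qed

lemma group_PGL2_UNIV: "group (PGL2 (UNIV :: 'a :: field set))"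
  unfolding PGL2_def by (rule normal.factorgroup_is_group[OF scalars_normal_GL2_UNIV])

lemma proj_eq: "proj A = {mat c ** A | c. c \<noteq> 0}"
  by (auto simp: proj_def r_coset_def GL2_def)

lemma proj_eq_iff: "proj A = proj B \<longleftrightarrow> A \<propto> B"
proof
  assume "proj A = proj B"
  moreover have "A \<in> proj A" unfolding proj_eq by (auto intro!: exI[of _ 1])
  ultimately show "A \<propto> B" by (auto simp: proj_eq peq_def)
next
  have "proj A \<subseteq> proj B" if "A \<propto> B" for A B :: "'a ^ 2 ^ 2"
  proof
    fix C assume "C \<in> proj A"
    then have "C \<propto> A" by (auto simp: proj_eq peq_def)
    then have "C \<propto> B" using that by (rule peq_trans)
    then show "C \<in> proj B" by (auto simp: proj_eq peq_def)
  qed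
  then show "A \<propto> B \<Longrightarrow> proj A = proj B" using peq_sym by blast
qed

lemma carrier_PGL2_UNIV: "carrier (PGL2 UNIV) = {proj A | A. det A \<noteq> 0}"
  by (auto simp: PGL2_def FactGroup_def RCOSETS_def proj_def GL2_def)

lemma proj_mult:
  "det A \<noteq> 0 \<Longrightarrow> det B \<noteq> 0 \<Longrightarrow> proj A \<otimes>\<^bsub>PGL2 UNIV\<^esub> proj B = proj (A ** B)"
  using normal.rcos_sum[OF scalars_normal_GL2_UNIV, of A B]
  by (simp add: PGL2_def FactGroup_def proj_def GL2_def)

lemma proj_one: "\<one>\<^bsub>PGL2 UNIV\<^esub> = proj (mat 1)"
  by (auto simp: PGL2_def FactGroup_def proj_eq)

section \<open>Projective representations of \<open>SL(2, q)\<close>\<close>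

text \<open>A homomorphism into PGL(2, K), lifted to arbitrarily chosen matrices. The last clause
  says that its kernel consists exactly of the scalars in \<open>S\<close>.\<close>

definition proj_hom :: "('a :: field ^ 2 ^ 2) set \<Rightarrow> ('a ^ 2 ^ 2 \<Rightarrow> 'a ^ 2 ^ 2) \<Rightarrow> bool" where
  "proj_hom S M \<longleftrightarrow> (\<forall>A\<in>S. det (M A) \<noteq> 0) \<and> (\<forall>A\<in>S. \<forall>B\<in>S. M (A ** B) \<propto> M A ** M B) \<and>
     (\<forall>A\<in>S. scalar (M A) \<longleftrightarrow> scalar A)"

lemma conj_mat: "A ** mat c ** adj A = mat (c * det A)" "adj A ** mat c ** A = mat (c * det A)"
  by (simp_all only: mat_mult_commute[of c, symmetric] matrix_mul_assoc[symmetric] adj_mult mat_mult_mat)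

lemma conj_conj: "C ** (adj C ** A ** C) ** adj C = mat ((det C)\<^sup>2) ** A"
proof -
  have "C ** (adj C ** A ** C) ** adj C = (C ** adj C) ** A ** (C ** adj C)"
    by (simp only: matrix_mul_assoc)
  also have "\<dots> = mat (det C) ** (A ** mat (det C))"
    by (simp only: adj_mult matrix_mul_assoc)
  also have "A ** mat (det C) = mat (det C) ** A"
    by (rule mat_mult_commute[symmetric])
  finally show ?thesis by (simp add: matrix_mul_assoc mat_mult_mat power2_eq_square)
qed

lemma scalar_conj_iff:
  assumes "det C \<noteq> 0"
  shows "scalar (adj C ** A ** C) \<longleftrightarrow> scalar A"
proof
  assume "scalar A"
  then show "scalar (adj C ** A ** C)" by (auto simp: scalar_def conj_mat)
next
  assume "scalar (adj C ** A ** C)"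
  then have "scalar (mat ((det C)\<^sup>2) ** A)"
    unfolding conj_conj[symmetric] by (auto simp: scalar_def conj_mat)
  then show "scalar A"
    using assms by (cases A rule: mat2_exhaust) (auto simp: mat_eq_mat2)
qed

lemma conj_mult_peq:
  assumes "det C \<noteq> 0"
  shows "adj C ** (A ** B) ** C \<propto> (adj C ** A ** C) ** (adj C ** B ** C)"
proof -
  have "(adj C ** A ** C) ** (adj C ** B ** C) = adj C ** A ** (C ** adj C) ** B ** C"
    by (simp only: matrix_mul_assoc)
  also have "\<dots> = (adj C ** A) ** mat (det C) ** (B ** C)"
    by (simp only: adj_mult matrix_mul_assoc)
  also have "(adj C ** A) ** mat (det C) = mat (det C) ** (adj C ** A)"
    by (rule mat_mult_commute[symmetric])
  finally show ?thesis
    using peq_sym[OF mat_mult_peq[OF assms, of "adj C ** (A ** B) ** C"]]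
    by (simp only: matrix_mul_assoc)
qed

lemma proj_hom_conj:
  assumes "proj_hom S M" "det C \<noteq> 0"
  shows "proj_hom S (\<lambda>A. adj C ** M A ** C)"
  unfolding proj_hom_def
proof (intro conjI ballI)
  fix A assume A: "A \<in> S"
  show "det (adj C ** M A ** C) \<noteq> 0"
    using assms A by (simp add: det_mul proj_hom_def)
  show "scalar (adj C ** M A ** C) \<longleftrightarrow> scalar A"
    using assms A by (simp add: scalar_conj_iff proj_hom_def)
  fix B assume B: "B \<in> S"
  have "adj C ** M (A ** B) ** C \<propto> adj C ** (M A ** M B) ** C"
    using assms A B by (intro peq_mult) (auto simp: proj_hom_def)
  also have "\<dots> \<propto> (adj C ** M A ** C) ** (adj C ** M B ** C)"
    using assms(2) by (rule conj_mult_peq)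
  finally show "adj C ** M (A ** B) ** C \<propto> (adj C ** M A ** C) ** (adj C ** M B ** C)" .
qed

text \<open>It suffices that the first column of \<open>C\<close> is an eigenvector of
  \<open>A\<close>. For \<open>c \<noteq> 0\<close> the vector (x, 1) is one exactly when x is a
  root of the quadratic below.\<close>

lemma triangularize:
  fixes A :: "'a :: alg_closed_field ^ 2 ^ 2"
  shows "\<exists>C. det C \<noteq> 0 \<and> (adj C ** A ** C) $ 2 $ 1 = 0"
proof -
  obtain a b c d where A: "A = mat2 a b c d" by (rule mat2_exhaust)
  show ?thesis
  proof (cases "c = 0")
    case True
    then show ?thesis by (intro exI[of _ "mat2 1 0 0 1"]) (simp add: A)
  next
    case False
    then obtain x where "poly [:- b, d - a, c:] x = 0"
      using alg_closed_imp_poly_has_root[of "[:- b, d - a, c:]"] by auto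
    then show ?thesis
      by (intro exI[of _ "mat2 x 1 1 0"]) (simp add: A algebra_simps)
  qed
qed

abbreviation u :: "'a :: field \<Rightarrow> 'a ^ 2 ^ 2" where
  "u x \<equiv> mat2 1 x 0 1"

abbreviation w :: "'a :: field ^ 2 ^ 2" where
  "w \<equiv> mat2 0 1 (- 1) 0"

lemma u_peq_iff: "u x \<propto> u y \<longleftrightarrow> x = y"
  by (auto simp: peq_def mat_eq_mat2)

lemma peq_mat2_iff: "A \<propto> mat2 a b c d \<longleftrightarrow> (\<exists>t. t \<noteq> 0 \<and> A = mat2 (t * a) (t * b) (t * c) (t * d))"
  by (simp add: peq_def mat_eq_mat2)

text \<open>In the square of \<open>A\<close> the off-diagonal entries and the difference of the
  diagonal entries are those of \<open>A\<close> times the trace; if the trace were nonzero,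
  \<open>A\<close> itself would be scalar.\<close>

lemma trace_zero_if_square_scalar:
  fixes A :: "'a :: field ^ 2 ^ 2"
  assumes "scalar (A ** A)" "\<not> scalar A"
  shows "A $ 1 $ 1 + A $ 2 $ 2 = 0"
proof -
  obtain a b c d where A: "A = mat2 a b c d" by (rule mat2_exhaust)
  have 1: "b * (a + d) = 0" "c * (a + d) = 0" "(a - d) * (a + d) = 0"
    using assms(1) unfolding A by (simp_all add: algebra_simps)
  then show ?thesis using assms(2) unfolding A by auto
qed

lemma two_neq_0_if_odd_char:
  assumes "prime CHAR('a :: field)" "odd CHAR('a)"
  shows "(2 :: 'a) \<noteq> 0"
proof
  assume "(2 :: 'a) = 0"
  then have "of_nat 2 = (0 :: 'a)" by simp
  then have "CHAR('a) dvd 2" by (simp only: of_nat_eq_0_iff_char_dvd)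
  then have "CHAR('a) = 2" by (rule primes_dvd_imp_eq[OF assms(1) two_is_prime_nat])
  then show False using assms(2) by simp
qed

section \<open>Normalizing the unipotent and the Weyl element by conjugation\<close>

text \<open>The set \<open>S\<close> lies between SL(2, q) and GL(2, q), so that the two
  alternatives for the group share one argument.\<close>

locale projective_rep = finite_subfield F for F :: "'a :: alg_closed_field set" +
  fixes q :: nat and S :: "('a ^ 2 ^ 2) set"
  assumes prime: "prime CHAR('a)" and odd: "odd CHAR('a)"
    and F: "F = {x. x ^ q = x}"
    and S_mult: "A \<in> S \<Longrightarrow> B \<in> S \<Longrightarrow> A ** B \<in> S"
    and SL2_in_S: "a \<in> F \<Longrightarrow> b \<in> F \<Longrightarrow> c \<in> F \<Longrightarrow> d \<in> F \<Longrightarrow> a * d - b * c = 1 \<Longrightarrow> mat2 a b c d \<in> S"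
    and S_entries: "A \<in> S \<Longrightarrow> A $ i $ j \<in> F"
    and S_det: "A \<in> S \<Longrightarrow> det A \<noteq> 0"
begin

lemma two_neq_0: "(2 :: 'a) \<noteq> 0"
  using prime odd by (rule two_neq_0_if_odd_char)

lemma u_in_S: "x \<in> F \<Longrightarrow> u x \<in> S"
  by (rule SL2_in_S) (auto simp: zero one)

lemma w_in_S: "w \<in> S"
  by (rule SL2_in_S) (auto simp: zero one uminus)

lemma proj_hom_mult:
  "proj_hom S M \<Longrightarrow> A \<in> S \<Longrightarrow> B \<in> S \<Longrightarrow> M A \<propto> A' \<Longrightarrow> M B \<propto> B' \<Longrightarrow> M (A ** B) \<propto> A' ** B'"
  by (meson proj_hom_def peq_mult peq_trans)

lemma proj_hom_scalar:
  "proj_hom S M \<Longrightarrow> A \<in> S \<Longrightarrow> M A \<propto> A' \<Longrightarrow> scalar A' \<longleftrightarrow> scalar A"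
  by (meson proj_hom_def peq_scalar)

text \<open>In characteristic \<open>p\<close> the relation \<open>u(1)\<^sup>p = 1\<close> forces the two eigenvalues of the image of
  \<open>u(1)\<close> to coincide.\<close>

lemma exists_conj_unipotent:
  assumes M: "proj_hom S M"
  shows "\<exists>C. det C \<noteq> 0 \<and> adj C ** M (u 1) ** C \<propto> u 1"
proof -
  obtain C where C: "det C \<noteq> 0" "(adj C ** M (u 1) ** C) $ 2 $ 1 = 0"
    using triangularize by blast
  define N where "N = (\<lambda>A. adj C ** M A ** C)"
  have N: "proj_hom S N" unfolding N_def using M C(1) by (rule proj_hom_conj)
  obtain a b d where Nu: "N (u 1) = mat2 a b 0 d"
    using C(2) by (metis mat2_eta N_def)
  have "det (N (u 1)) \<noteq> 0" using N u_in_S[OF one] by (simp add: proj_hom_def)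
  then have ad: "a \<noteq> 0" "d \<noteq> 0" unfolding Nu by auto
  have N1: "N (mat 1) \<propto> mat2 1 0 0 1"
  proof -
    have "mat 1 \<in> S" using u_in_S[OF zero] by (simp add: mat_eq_mat2)
    then have "scalar (N (mat 1))" "det (N (mat 1)) \<noteq> 0" using N by (auto simp: proj_hom_def)
    then obtain c where "N (mat 1) = mat c" "c \<noteq> 0" by (auto simp: scalar_def)
    then show ?thesis by (auto simp: peq_mat2_iff mat_eq_mat2)
  qed
  have "\<exists>\<beta>. N (u (of_nat n)) \<propto> mat2 (a ^ n) \<beta> 0 (d ^ n)" for n
  proof (induction n)
    case 0
    then show ?case using N1 by (auto simp: mat_eq_mat2)
  next
    case (Suc n)
    then obtain \<beta> where "N (u (of_nat n)) \<propto> mat2 (a ^ n) \<beta> 0 (d ^ n)" by blast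
    then have "N (u 1 ** u (of_nat n)) \<propto> mat2 a b 0 d ** mat2 (a ^ n) \<beta> 0 (d ^ n)"
      by (intro proj_hom_mult[OF N] u_in_S) (auto simp: Nu one of_nat)
    then show ?case by (auto simp: add.commute)
  qed
  then obtain \<beta> where \<beta>: "N (u 0) \<propto> mat2 (a ^ CHAR('a)) \<beta> 0 (d ^ CHAR('a))"
    by (metis of_nat_CHAR)
  have "a ^ CHAR('a) = d ^ CHAR('a)"
    using proj_hom_scalar[OF N u_in_S[OF zero] \<beta>] by simp
  moreover have "(a - d) ^ CHAR('a) = a ^ CHAR('a) - d ^ CHAR('a)"
    using freshmans_dream[OF prime refl, of "a - d" d] by simp
  ultimately have "a = d" by auto
  moreover have "\<not> scalar (N (u 1))"
    using N u_in_S[OF one] by (simp add: proj_hom_def)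
  ultimately have b: "b \<noteq> 0" unfolding Nu by auto
  \<comment> \<open>With equal eigenvalues, \<open>N (u 1)\<close> is \<open>a\<close> times
    \<open>u (b / a)\<close>; conjugation by this diagonal matrix rescales the entry
    \<open>b / a\<close> to 1.\<close>
  define E where "E = mat2 (b / a) 0 0 1"
  have "adj E ** N (u 1) ** E \<propto> u 1"
    unfolding Nu E_def peq_mat2_iff using \<open>a = d\<close> ad b by (intro exI[of _ b]) simp
  moreover have "adj E ** N (u 1) ** E = adj (C ** E) ** M (u 1) ** (C ** E)"
  proof -
    have "adj (C ** E) = adj E ** adj C"
      by (cases C rule: mat2_exhaust) (simp add: E_def algebra_simps)
    then show ?thesis by (simp add: N_def matrix_mul_assoc)
  qed
  moreover have "det (C ** E) \<noteq> 0" using C(1) b ad by (simp add: det_mul E_def)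
  ultimately show ?thesis by metis
qed

text \<open>\<open>w\<^sup>2\<close> being scalar makes the image of \<open>w\<close> traceless; conjugation by some \<open>u(y)\<close> makes it
  antidiagonal, and \<open>(w u(1))\<^sup>3\<close> being scalar then determines it.\<close>

lemma exists_conj_unipotent_Weyl:
  assumes M: "proj_hom S M" and u1: "M (u 1) \<propto> u 1"
  shows "\<exists>C. det C \<noteq> 0 \<and> adj C ** M (u 1) ** C \<propto> u 1 \<and> adj C ** M w ** C \<propto> w"
proof -
  obtain \<alpha> \<beta> \<gamma> \<delta> where Mw: "M w = mat2 \<alpha> \<beta> \<gamma> \<delta>" by (rule mat2_exhaust)
  have det: "\<alpha> * \<delta> - \<beta> * \<gamma> \<noteq> 0" using M w_in_S by (metis Mw det_mat2 proj_hom_def)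
  have "scalar (M w ** M w)"
    using proj_hom_scalar[OF M S_mult[OF w_in_S w_in_S] proj_hom_mult[OF M w_in_S w_in_S]]
    by auto
  moreover have "\<not> scalar (M w)" using M w_in_S by (simp add: proj_hom_def)
  ultimately have "\<delta> = - \<alpha>"
    using trace_zero_if_square_scalar[of "M w"] by (simp add: Mw add_eq_0_iff)
  have wu: "w ** u 1 \<in> S" by (intro S_mult w_in_S u_in_S one)
  have Mwu: "M (w ** u 1) \<propto> M w ** u 1"
    by (intro proj_hom_mult[OF M] w_in_S u_in_S one u1 peq_refl)
  \<comment> \<open>Otherwise \<open>M w ** u 1\<close> is triangular and traceless, so its square
    is scalar, whereas \<open>w ** u 1\<close> has order 3 modulo scalars.\<close>
  have "\<gamma> \<noteq> 0"
  proof
    assume "\<gamma> = 0"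
    have "scalar ((M w ** u 1) ** (M w ** u 1)) \<longleftrightarrow> scalar ((w ** u 1) ** (w ** u (1 :: 'a)))"
      by (rule proj_hom_scalar[OF M S_mult[OF wu wu] proj_hom_mult[OF M wu wu Mwu Mwu]])
    then show False
      by (simp add: Mw \<open>\<gamma> = 0\<close> \<open>\<delta> = - \<alpha>\<close>)
  qed
  \<comment> \<open>Since \<open>M w\<close> is traceless, conjugation by this unipotent clears both
    diagonal entries; it commutes with \<open>u 1\<close>, so the first normalization
    survives.\<close>
  define C where "C = u (\<alpha> / \<gamma>)"
  have detC: "det C \<noteq> 0" by (simp add: C_def)
  define N where "N = (\<lambda>A. adj C ** M A ** C)"
  have N: "proj_hom S N" unfolding N_def using M detC by (rule proj_hom_conj)
  have Nu: "N (u 1) \<propto> u 1"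
  proof -
    have "N (u 1) \<propto> adj C ** u 1 ** C" unfolding N_def using u1 by (intro peq_mult peq_refl)
    then show ?thesis by (simp add: C_def)
  qed
  define t where "t = - (\<beta> + \<alpha> / \<gamma> * \<alpha>) / \<gamma>"
  have "N w = mat2 0 (- \<gamma> * t) \<gamma> 0"
    unfolding N_def C_def t_def Mw using \<open>\<gamma> \<noteq> 0\<close> \<open>\<delta> = - \<alpha>\<close> by (simp add: field_simps)
  then have Nw: "N w \<propto> mat2 0 t (- 1) 0"
    unfolding peq_mat2_iff using \<open>\<gamma> \<noteq> 0\<close> by (intro exI[of _ "- \<gamma>"]) simp
  have Nwu: "N (w ** u 1) \<propto> mat2 0 t (- 1) 0 ** u 1"
    by (intro proj_hom_mult[OF N] w_in_S u_in_S one Nu Nw)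
  have "scalar ((mat2 0 t (- 1) 0 ** u 1) ** ((mat2 0 t (- 1) 0 ** u 1) ** (mat2 0 t (- 1) 0 ** u 1)))
     \<longleftrightarrow> scalar ((w ** u 1) ** ((w ** u 1) ** (w ** u (1 :: 'a))))"
    by (rule proj_hom_scalar[OF N S_mult[OF wu S_mult[OF wu wu]]
          proj_hom_mult[OF N wu S_mult[OF wu wu] Nwu proj_hom_mult[OF N wu wu Nwu Nwu]]])
  \<comment> \<open>The matrix \<open>mat2 0 t (- 1) 0 ** u 1\<close> has trace -1 and determinant
    \<open>t\<close>. By Cayley-Hamilton its cube is \<open>1 - t\<close> times itself plus a scalar
    matrix.\<close>
  then have "t = 1" by (simp add: algebra_simps)
  then show ?thesis using detC Nu Nw unfolding N_def by blast
qed

end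

section \<open>Normalized representations are powers of the Frobenius map\<close>

lemma map_mat_mult:
  assumes "\<And>x y. f (x * y) = f x * f y" "\<And>x y. f (x + y) = f x + f y"
  shows "map_mat f (A ** B) = map_mat f A ** map_mat f B"
  by (cases A rule: mat2_exhaust, cases B rule: mat2_exhaust) (simp add: assms)

context projective_rep
begin

context
  fixes M
  assumes M: "proj_hom S M" and Mu: "M (u 1) \<propto> u 1" and Mw: "M w \<propto> w"
begin

text \<open>The image of \<open>u x\<close> commutes with \<open>u 1\<close> up to a scalar, and the
  centralizer of \<open>u 1\<close> in PGL(2, K) consists of the classes of the
  \<open>u y\<close>.\<close>

lemma exists_additive: "x \<in> F \<Longrightarrow> \<exists>y. M (u x) \<propto> u y"
proof -
  assume x: "x \<in> F"
  obtain a b c d where Mx: "M (u x) = mat2 a b c d" by (rule mat2_exhaust)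
  have det: "a * d - b * c \<noteq> 0" using M u_in_S[OF x] by (metis Mx det_mat2 proj_hom_def)
  have "u x ** u 1 = u 1 ** u x" by simp
  then have "M (u x ** u 1) = M (u 1 ** u x)" by (simp only:)
  then have "mat2 a b c d ** u 1 \<propto> u 1 ** mat2 a b c d"
    using peq_trans[OF peq_sym[OF proj_hom_mult[OF M u_in_S[OF x] u_in_S[OF one] peq_refl Mu]]]
      proj_hom_mult[OF M u_in_S[OF one] u_in_S[OF x] Mu peq_refl]
    unfolding Mx by simp
  then have "\<exists>t. t \<noteq> 0 \<and> a = t * (a + c) \<and> a + b = t * (b + d) \<and> c = t * c \<and> c + d = t * d"
    by (simp add: peq_mat2_iff)
  then obtain t where t: "t \<noteq> 0" "a = t * (a + c)" "a + b = t * (b + d)" "c = t * c" "c + d = t * d"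
    by blast
  have "c = 0" using t(4,5) by (cases "t = 1") auto
  moreover have "t = 1" using det t(2) \<open>c = 0\<close> by auto
  ultimately have "M (u x) = mat2 (d * 1) (d * (b / d)) (d * 0) (d * 1)" "d \<noteq> 0"
    using t det Mx by auto
  then show ?thesis unfolding peq_mat2_iff by blast
qed

lemma exists_Frobenius_on_unipotents: "\<exists>i. \<forall>x\<in>F. M (u x) \<propto> u (x ^ (CHAR('a) ^ i))"
proof -
  obtain f where f: "\<And>x. x \<in> F \<Longrightarrow> M (u x) \<propto> u (f x)"
    using exists_additive by metis
  have f_eqI: "f x = y" if "x \<in> F" "M (u x) \<propto> u y" for x y
    using f[OF that(1)] that(2) by (meson peq_sym peq_trans u_peq_iff)
  have f1: "f 1 = 1" using f_eqI one Mu by blast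
  have f_add: "f (x + y) = f x + f y" if "x \<in> F" "y \<in> F" for x y
  proof (rule f_eqI)
    show "M (u (x + y)) \<propto> u (f x + f y)"
      using proj_hom_mult[OF M u_in_S u_in_S f f] that by (simp add: add.commute)
  qed (use that add in auto)
  have f0: "f 0 = 0" using f_add[OF zero zero] by (metis add.right_neutral add_left_cancel)
  have f_inverse: "f (inverse x) = inverse (f x)" if x: "x \<in> F" for x
  proof (cases "x = 0")
    case False
    txt \<open>\<open>n x y\<close> has trace \<open>2 (x y - 1)\<close>, and its square is scalar for \<open>y = 1 / x\<close>.\<close>
    define n where "n = (\<lambda>x y :: 'a. u x ** (w ** (u y ** (w ** u x))))"
    have ix: "inverse x \<in> F" using x by (rule inverse)
    have S: "n x (inverse x) \<in> S"
      unfolding n_def by (intro S_mult u_in_S w_in_S x ix)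
    have Mn: "M (n x (inverse x)) \<propto> n (f x) (f (inverse x))"
      unfolding n_def by (intro proj_hom_mult[OF M] S_mult u_in_S w_in_S x ix f Mw)
    have "scalar (n x (inverse x) ** n x (inverse x))" "\<not> scalar (n x (inverse x))"
      unfolding n_def using False by (simp_all add: algebra_simps)
    then have "scalar (n (f x) (f (inverse x)) ** n (f x) (f (inverse x)))"
      "\<not> scalar (n (f x) (f (inverse x)))"
      using proj_hom_scalar[OF M S_mult[OF S S] proj_hom_mult[OF M S S Mn Mn]]
        proj_hom_scalar[OF M S Mn] by auto
    then have "n (f x) (f (inverse x)) $ 1 $ 1 + n (f x) (f (inverse x)) $ 2 $ 2 = 0"
      by (rule trace_zero_if_square_scalar)
    then have "2 * (f x * f (inverse x) - 1) = 0"
      unfolding n_def by (simp add: algebra_simps)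
    then have "f x * f (inverse x) = 1" using two_neq_0 by simp
    then show ?thesis by (simp add: inverse_unique)
  qed (simp add: f0)
  have f_neg: "f (- x) = - f x" if "x \<in> F" for x
    using f_add[OF that uminus[OF that]] f0 by (simp add: eq_neg_iff_add_eq_0 add.commute)
  txt \<open>Additivity and compatibility with inversion give multiplicativity through
    \<open>1 / x - 1 / (x + 1) = 1 / (x\<^sup>2 + x)\<close> and polarization.\<close>
  have f_square: "f (x * x) = f x * f x" if x: "x \<in> F" for x
  proof (cases "x = 0 \<or> x + 1 = 0")
    \<comment> \<open>At 0 and -1 one of the inverses in the identity above does not exist, so these
      values are checked directly.\<close>
    case True
    then have "x = 0 \<or> x = - 1" by (simp add: eq_neg_iff_add_eq_0)
    then show ?thesis using f0 f1 f_neg[OF one] by auto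
  next
    case False
    have x1: "x + 1 \<in> F" using add x one by blast
    have "f x \<noteq> 0"
      using proj_hom_scalar[OF M u_in_S[OF x] f[OF x]] False by auto
    have "f (x + 1) \<noteq> 0"
      using proj_hom_scalar[OF M u_in_S[OF x1] f[OF x1]] False by auto
    have "inverse (f (x * (x + 1))) = f (inverse (x * (x + 1)))"
      using f_inverse[OF mult[OF x x1]] by (simp only:)
    also have "inverse (x * (x + 1)) = inverse x + - inverse (x + 1)"
      using False by (simp add: field_simps)
    also have "f \<dots> = inverse (f x) - inverse (f x + 1)"
      using f_add[OF inverse[OF x] uminus[OF inverse[OF x1]]] f_neg[OF inverse[OF x1]]
        f_inverse[OF x] f_inverse[OF x1] f_add[OF x one] f1 by simp
    also have "\<dots> = inverse (f x * (f x + 1))"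
      using \<open>f x \<noteq> 0\<close> \<open>f (x + 1) \<noteq> 0\<close> f_add[OF x one] f1 by (simp add: field_simps)
    finally have "f (x * (x + 1)) = f x * (f x + 1)" by (simp only: inverse_eq_iff_eq)
    then show ?thesis
      using f_add[OF mult[OF x x] x] by (simp add: algebra_simps)
  qed
  have f_mult: "f (x * y) = f x * f y" if "x \<in> F" "y \<in> F" for x y
  proof -
    have "(x + y) * (x + y) = x * x + ((x * y + x * y) + y * y)"
      by (simp add: algebra_simps)
    then have "f ((x + y) * (x + y)) = f (x * x) + (f (x * y) + f (x * y) + f (y * y))"
      using that by (simp only: f_add mult add)
    moreover have "f ((x + y) * (x + y)) = (f x + f y) * (f x + f y)"
      using that by (simp only: f_square f_add add)
    ultimately have "2 * f (x * y) = 2 * (f x * f y)"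
      using that by (simp add: f_square algebra_simps)
    then show ?thesis using two_neq_0 by simp
  qed
  have f_power: "f (x ^ n) = f x ^ n" if "x \<in> F" for x n
    by (induction n) (use that in \<open>auto simp: f1 f_mult power\<close>)
  have "\<exists>i. \<forall>x\<in>F. f x = x ^ (CHAR('a) ^ i)"
  proof (rule endomorphism_is_Frobenius[OF prime f1 _ f_add f_mult])
    \<comment> \<open>Membership in \<open>F\<close> is the equation \<open>x ^ q = x\<close>, which
      \<open>f\<close> preserves because it respects powers.\<close>
    fix x assume "x \<in> F"
    moreover from this have "x ^ q = x" using F by blast
    ultimately show "f x \<in> F" using f_power[of x q] F by auto
  qed auto
  then show ?thesis using f by metis
qed

text \<open>Agreement on \<open>w\<close> and all \<open>u x\<close> extends to SL(2, q) by the
  Bruhat decomposition. It extends further to \<open>S\<close> because an element of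
  \<open>S\<close> is determined up to scalars by its conjugation action on SL(2, q).\<close>

lemma exists_Frobenius_normalized: "\<exists>i. \<forall>A\<in>S. M A \<propto> map_mat (\<lambda>x. x ^ (CHAR('a) ^ i)) A"
proof -
  obtain i where i: "\<And>x. x \<in> F \<Longrightarrow> M (u x) \<propto> u (x ^ (CHAR('a) ^ i))"
    using exists_Frobenius_on_unipotents by blast
  define f :: "'a \<Rightarrow> 'a" where "f = (\<lambda>x. x ^ (CHAR('a) ^ i))"
  have p: "CHAR('a) > 0" using prime by (simp add: prime_gt_0_nat)
  have f0: "f 0 = 0" and f1: "f 1 = 1" using p by (simp_all add: f_def)
  have f_mult: "f (x * y) = f x * f y" for x y by (simp add: f_def power_mult_distrib)
  have f_add: "f (x + y) = f x + f y" for x y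
    unfolding f_def by (rule freshmans_dream'[OF prime refl])
  have f_neg: "f (- x) = - f x" for x
    using f_add[of x "- x"] f0 by (simp add: eq_neg_iff_add_eq_0 add.commute)
  have f_diff: "f (x - y) = f x - f y" for x y
    using f_add[of "x - y" y] by simp
  have f_eq0: "f x = 0 \<longleftrightarrow> x = 0" for x using p by (simp add: f_def)
  have f_hom: "map_mat f (A ** B) = map_mat f A ** map_mat f B" for A B
    by (rule map_mat_mult) (auto simp: f_mult f_add)
  have fM_mult: "M (A ** B) \<propto> map_mat f (A ** B)"
    if "A \<in> S" "B \<in> S" "M A \<propto> map_mat f A" "M B \<propto> map_mat f B" for A B
    unfolding f_hom using that by (rule proj_hom_mult[OF M])
  have fu: "M (u x) \<propto> map_mat f (u x)" if "x \<in> F" for x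
    using i[OF that] by (simp add: f0 f1) (simp add: f_def)
  have fw: "M w \<propto> map_mat f w" using Mw by (simp add: f0 f1 f_neg)
  have SL2_big_cell: "M (mat2 a b c d) \<propto> map_mat f (mat2 a b c d)"
    if "a \<in> F" "b \<in> F" "c \<in> F" "d \<in> F" "a * d - b * c = 1" "c \<noteq> 0" for a b c d
  proof -
    have "a * d = 1 + b * c" using that by (simp add: algebra_simps)
    \<comment> \<open>The factor \<open>w ** (u c ** w)\<close> is lower unipotent up to sign, with
      entry \<open>c\<close> in the corner; the outer unipotents adjust the diagonal to
      \<open>a\<close> and \<open>d\<close>, and the determinant then fixes
      \<open>b\<close>.\<close>
    then have "mat2 a b c d = u ((a + 1) / c) ** (w ** (u c ** (w ** u ((d + 1) / c))))"
      using that by (simp add: field_simps)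
    moreover have "(a + 1) / c \<in> F" "(d + 1) / c \<in> F"
      using that by (simp_all add: divide add one)
    ultimately show ?thesis
      using that by (simp only:) (intro fM_mult S_mult u_in_S w_in_S fu fw; simp)
  qed
  have SL2: "M (mat2 a b c d) \<propto> map_mat f (mat2 a b c d)"
    if F: "a \<in> F" "b \<in> F" "c \<in> F" "d \<in> F" and det: "a * d - b * c = 1" for a b c d
  proof (cases "c = 0")
    case True
    then have "a \<noteq> 0" using det by auto
    have det': "- c * b - (- d) * a = 1" using det by (simp add: algebra_simps)
    \<comment> \<open>Splitting off \<open>w\<close> moves the nonzero entry \<open>a\<close> to the
      lower left corner, which reduces this case to the big cell.\<close>
    have "mat2 a b c d = w ** mat2 (- c) (- d) a b" by simp
    moreover have "M (w ** mat2 (- c) (- d) a b) \<propto> map_mat f (w ** mat2 (- c) (- d) a b)"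
      by (intro fM_mult w_in_S fw SL2_in_S SL2_big_cell uminus F det' \<open>a \<noteq> 0\<close>)
    ultimately show ?thesis by (simp only:)
  qed (use SL2_big_cell that in auto)
  have "M A \<propto> map_mat f A" if A: "A \<in> S" for A
  proof -
    obtain a b c d where A_eq: "A = mat2 a b c d" by (rule mat2_exhaust)
    have F: "a \<in> F" "b \<in> F" "c \<in> F" "d \<in> F" using S_entries[OF A] unfolding A_eq by (metis mat2_nth)+
    txt \<open>\<open>B\<close> below commutes in \<open>PGL(2, K)\<close> with the image of \<open>SL(2, q)\<close>, because conjugation by
      \<open>A\<close> preserves \<open>SL(2, q)\<close>; hence it is scalar.\<close>
    define \<delta> where "\<delta> = det A"
    have \<delta>: "\<delta> \<noteq> 0" "\<delta> = a * d - b * c" "\<delta> \<in> F" using S_det[OF A] F by (auto simp: \<delta>_def A_eq mult diff)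
    define B where "B = adj (map_mat f A) ** M A"
    have det_fA: "det (map_mat f A) = f \<delta>" "f \<delta> \<noteq> 0"
      using \<delta>(1) f_eq0[of \<delta>] by (simp add: A_eq f_diff f_mult \<delta>(2), simp)
    have commute: "B ** map_mat f T \<propto> map_mat f T ** B"
      if T_eq: "T = mat2 x y z t" and T: "x \<in> F" "y \<in> F" "z \<in> F" "t \<in> F" "x * t - y * z = 1" for T x y z t
    proof -
      \<comment> \<open>This is the conjugate of \<open>T\<close> by \<open>A\<close>. It lies in
        SL(2, q) even if \<open>A\<close> does not, so the formula already proved applies to
        it.\<close>
      define T' where "T' = mat (1 / \<delta>) ** (A ** T ** adj A)"
      have TS: "T \<in> S" unfolding T_eq using T by (intro SL2_in_S)
      have AT: "A ** T = T' ** A"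
      proof -
        have "T' ** A = mat (1 / \<delta>) ** (A ** T ** (adj A ** A))" by (simp only: T'_def matrix_mul_assoc)
        also have "\<dots> = mat (1 / \<delta>) ** (mat \<delta> ** (A ** T))"
          by (simp only: adj_mult \<delta>_def[symmetric] mat_mult_commute[of \<delta>])
        finally show ?thesis using \<delta> by (simp add: matrix_mul_assoc mat_mult_mat)
      qed
      obtain x' y' z' t' where T'_eq: "T' = mat2 x' y' z' t'" by (rule mat2_exhaust)
      have T'F: "x' \<in> F" "y' \<in> F" "z' \<in> F" "t' \<in> F"
      proof -
        have "1 / \<delta> \<in> F" using \<delta> one divide by blast
        then show "x' \<in> F" "y' \<in> F" "z' \<in> F" "t' \<in> F"
          using F T T'_eq unfolding T'_def A_eq T_eq
          by (auto simp: mat_eq_mat2 intro!: mult add diff divide \<delta>)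
      qed
      have "det T' = 1"
        using \<delta> T by (simp add: T'_def det_mul T_eq power2_eq_square flip: \<delta>_def)
      then have T'S: "T' \<in> S" and fT': "M T' \<propto> map_mat f T'"
        unfolding T'_eq using T'F by (simp_all add: SL2_in_S SL2 del: map_mat_mat2)
      have "M A ** map_mat f T \<propto> M (A ** T)"
        using T by (intro peq_sym[OF proj_hom_mult[OF M A TS]] peq_refl) (simp add: T_eq SL2 del: map_mat_mat2)
      also have "\<dots> \<propto> map_mat f T' ** M A"
        unfolding AT by (intro proj_hom_mult[OF M T'S A] peq_refl fT')
      finally have "B ** map_mat f T \<propto> adj (map_mat f A) ** (map_mat f T' ** M A)"
        unfolding B_def matrix_mul_assoc[symmetric] by (rule peq_mult[OF peq_refl])
      also have "\<dots> \<propto> map_mat f T ** B"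
      proof (rule peq_cancel_left)
        show "det (map_mat f A) \<noteq> 0" using det_fA by simp
        have "map_mat f A ** (adj (map_mat f A) ** (map_mat f T' ** M A)) \<propto> map_mat f T' ** M A"
          using det_fA by (simp add: matrix_mul_assoc adj_mult)
            (simp add: mat_mult_peq flip: matrix_mul_assoc)
        moreover have "map_mat f A ** (map_mat f T ** B) \<propto> map_mat f T' ** M A"
        proof -
          have "map_mat f A ** (map_mat f T ** B) = map_mat f T' ** ((map_mat f A ** adj (map_mat f A)) ** M A)"
            unfolding B_def matrix_mul_assoc f_hom[symmetric] AT ..
          also have "\<dots> \<propto> map_mat f T' ** M A"
            using det_fA by (intro peq_mult peq_refl) (simp add: adj_mult mat_mult_peq)
          finally show ?thesis .
        qed
        ultimately show "map_mat f A ** (adj (map_mat f A) ** (map_mat f T' ** M A))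
          \<propto> map_mat f A ** (map_mat f T ** B)"
          by (rule peq_trans[OF _ peq_sym])
      qed
      finally show ?thesis .
    qed
    obtain b1 b2 b3 b4 where B: "B = mat2 b1 b2 b3 b4" by (rule mat2_exhaust)
    have "det B \<noteq> 0" using det_fA M A by (simp add: B_def det_mul proj_hom_def)
    then have b: "b1 * b4 - b2 * b3 \<noteq> 0" by (simp add: B)
    \<comment> \<open>Commuting with \<open>u 1\<close> makes \<open>B\<close> a multiple of some
      \<open>u y\<close>; commuting with \<open>w\<close> then removes the remaining off-diagonal
      entry.\<close>
    have "B ** u 1 \<propto> u 1 ** B"
      using commute[of "u 1" 1 1 0 1] by (simp add: f0 f1 zero one)
    then have "\<exists>t. t \<noteq> 0 \<and> b1 = t * (b1 + b3) \<and> b1 + b2 = t * (b2 + b4) \<and> b3 = t * b3 \<and> b3 + b4 = t * b4"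
      by (simp add: B peq_mat2_iff)
    then obtain t where t: "t \<noteq> 0" "b1 = t * (b1 + b3)" "b1 + b2 = t * (b2 + b4)" "b3 = t * b3" "b3 + b4 = t * b4"
      by blast
    have "b3 = 0" using t(4,5) by (cases "t = 1") auto
    moreover have "t = 1" using b t \<open>b3 = 0\<close> by auto
    ultimately have b14: "b1 = b4" using t by simp
    have "B ** w \<propto> w ** B"
      using commute[of w 0 1 "- 1" 0] by (simp add: f0 f1 f_neg zero one uminus)
    then have "b2 = 0" using b b14 \<open>b3 = 0\<close> by (auto simp: B peq_mat2_iff)
    then have "B = mat b1" "b1 \<noteq> 0" using b b14 \<open>b3 = 0\<close> B by (auto simp: mat_eq_mat2)
    then have "adj (map_mat f A) ** M A \<propto> mat 1"
      unfolding B_def by (auto simp: peq_def)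
    also have "mat 1 \<propto> adj (map_mat f A) ** map_mat f A"
      using det_fA by (simp add: adj_mult) (rule peq_sym, rule peqI[of "f \<delta>"], auto)
    finally show ?thesis
      using peq_cancel_left[of "adj (map_mat f A)"] det_fA by simp
  qed
  then show ?thesis unfolding f_def by blast
qed

end

theorem \<tau>_proj_hom:
  assumes "proj_hom S M"
  shows "\<exists>i. \<forall>A\<in>S. \<tau> (M A) = \<tau> A ^ (CHAR('a) ^ i)"
proof -
  obtain C where C: "det C \<noteq> 0" "adj C ** M (u 1) ** C \<propto> u 1"
    using exists_conj_unipotent[OF assms] by blast
  define N where "N = (\<lambda>A. adj C ** M A ** C)"
  have N: "proj_hom S N" unfolding N_def using assms C(1) by (rule proj_hom_conj)
  obtain E where E: "det E \<noteq> 0" "adj E ** N (u 1) ** E \<propto> u 1" "adj E ** N w ** E \<propto> w"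
    using exists_conj_unipotent_Weyl[OF N] C(2) unfolding N_def by blast
  obtain i where i: "\<And>A. A \<in> S \<Longrightarrow> adj E ** N A ** E \<propto> map_mat (\<lambda>x. x ^ (CHAR('a) ^ i)) A"
    using exists_Frobenius_normalized[OF proj_hom_conj[OF N E(1)] E(2,3)] by blast
  have adj_adj: "adj (adj B) = B" for B :: "'a ^ 2 ^ 2"
    by (cases B rule: mat2_exhaust) simp
  have inv: "\<tau> (adj B ** A ** B) = \<tau> A" if "det B \<noteq> 0" for A B :: "'a ^ 2 ^ 2"
    using \<tau>_conj[of "adj B" A] that by (simp add: adj_adj)
  have "\<tau> (M A) = \<tau> A ^ (CHAR('a) ^ i)" if "A \<in> S" for A
  proof -
    have "\<tau> (M A) = \<tau> (adj E ** N A ** E)" using C E by (simp add: inv N_def)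
    also have "\<dots> = \<tau> (map_mat (\<lambda>x. x ^ (CHAR('a) ^ i)) A)" using i[OF that] by (rule peq_\<tau>)
    also have "\<dots> = \<tau> A ^ (CHAR('a) ^ i)"
    proof -
      define f :: "'a \<Rightarrow> 'a" where "f = (\<lambda>x. x ^ (CHAR('a) ^ i))"
      have f_add: "f (x + y) = f x + f y" for x y
        unfolding f_def by (rule freshmans_dream'[OF prime refl])
      have f_diff: "f (x - y) = f x - f y" for x y
        using f_add[of "x - y" y] by simp
      have f_mult: "f (x * y) = f x * f y" and f_div: "f (x / y) = f x / f y" for x y
        by (simp_all add: f_def power_mult_distrib power_divide)
      have "\<tau> (map_mat f A) = f (\<tau> A)"
        by (cases A rule: mat2_exhaust) (simp add: f_add f_diff f_mult f_div power2_eq_square)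
      then show ?thesis by (simp add: f_def)
    qed
    finally show ?thesis .
  qed
  then show ?thesis by blast
qed

end

section \<open>From matrix representations to homomorphisms of abstract groups\<close>

text \<open>As \<open>\<tau>\<close> is constant on projective classes, the arbitrary choice of a
  representative is harmless.\<close>

definition class_\<tau> :: "('a :: field ^ 2 ^ 2) set \<Rightarrow> 'a" where
  "class_\<tau> g = \<tau> (SOME A. A \<in> g)"

lemma class_\<tau>_proj [simp]: "class_\<tau> (proj A) = \<tau> A"
proof -
  have "A \<in> proj A" unfolding proj_eq by (auto intro!: exI[of _ 1])
  then have "(SOME B. B \<in> proj A) \<in> proj A" by (rule someI)
  then have "(SOME B. B \<in> proj A) \<propto> A" by (auto simp: proj_eq peq_def)
  then show ?thesis unfolding class_\<tau>_def by (rule peq_\<tau>)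
qed

text \<open>Choosing a matrix \<open>M A\<close> in each class \<open>h A\<close> turns the
  homomorphism into a \<open>proj_hom\<close>.\<close>

lemma (in projective_rep) class_\<tau>_hom:
  assumes h_carrier: "\<And>A. A \<in> S \<Longrightarrow> h A \<in> carrier (PGL2 UNIV)"
    and h_mult: "\<And>A B. A \<in> S \<Longrightarrow> B \<in> S \<Longrightarrow> h (A ** B) = h A \<otimes>\<^bsub>PGL2 UNIV\<^esub> h B"
    and h_one: "\<And>A. A \<in> S \<Longrightarrow> h A = \<one>\<^bsub>PGL2 UNIV\<^esub> \<longleftrightarrow> scalar A"
  shows "\<exists>i. \<forall>A\<in>S. class_\<tau> (h A) = \<tau> A ^ (CHAR('a) ^ i)"
proof -
  obtain M where M: "\<And>A. A \<in> S \<Longrightarrow> det (M A) \<noteq> 0 \<and> h A = proj (M A)"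
    using h_carrier unfolding carrier_PGL2_UNIV mem_Collect_eq by metis
  have "proj_hom S M"
    unfolding proj_hom_def
  proof (intro conjI ballI)
    fix A assume A: "A \<in> S"
    show "det (M A) \<noteq> 0" using M A by blast
    have "scalar (M A) \<longleftrightarrow> M A \<propto> mat 1"
    proof
      assume "scalar (M A)"
      then obtain c where "M A = mat c" by (auto simp: scalar_def)
      then show "M A \<propto> mat 1" using M[OF A] by (intro peqI[of c]) auto
    qed (auto simp: peq_def)
    then show "scalar (M A) \<longleftrightarrow> scalar A"
      using M[OF A] h_one[OF A] by (simp add: proj_one proj_eq_iff)
    fix B assume B: "B \<in> S"
    show "M (A ** B) \<propto> M A ** M B"
      using h_mult[OF A B] M[OF A] M[OF B] M[OF S_mult[OF A B]]
      by (simp add: proj_mult proj_eq_iff)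
  qed
  then obtain i where "\<forall>A\<in>S. \<tau> (M A) = \<tau> A ^ (CHAR('a) ^ i)" using \<tau>_proj_hom by blast
  then show ?thesis using M by (intro exI[of _ i]) simp
qed

text \<open>Composing the quotient map with the inverse of the given isomorphism presents an
  abstract copy of PSL(2, q) or PGL(2, q) as an image of concrete matrices.\<close>

lemma scalar_quotient_iso_hom:
  fixes S :: "('a :: field ^ 2 ^ 2) set"
  assumes one: "mat 1 \<in> S"
    and mult: "\<And>A B. A \<in> S \<Longrightarrow> B \<in> S \<Longrightarrow> A ** B \<in> S"
    and inverse: "\<And>A. A \<in> S \<Longrightarrow> \<exists>B\<in>S. B ** A = mat 1"
    and K: "K = \<lparr>carrier = S, mult = (**), one = mat 1\<rparr>"
    and N: "N = {A \<in> S. scalar A}"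
    and G: "group G" and iso: "G \<cong> K Mod N"
  shows "\<exists>h. h ` S = carrier G \<and> (\<forall>A\<in>S. \<forall>B\<in>S. h (A ** B) = h A \<otimes>\<^bsub>G\<^esub> h B) \<and>
    (\<forall>A\<in>S. h A = \<one>\<^bsub>G\<^esub> \<longleftrightarrow> scalar A)"
proof -
  have K_group: "group K" by (rule matrix_group[OF one mult inverse K N])
  have normal: "N \<lhd> K" by (rule scalars_normal[OF one mult inverse K N])
  interpret normal N K by (fact normal)
  have "K Mod N \<cong> G" using iso G by (rule group.iso_sym[rotated])
  then obtain \<psi> where \<psi>: "\<psi> \<in> iso (K Mod N) G" by (auto simp: is_iso_def)
  then have \<psi>_hom: "\<psi> \<in> hom (K Mod N) G" and \<psi>_bij: "bij_betw \<psi> (carrier (K Mod N)) (carrier G)"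
    by (auto simp: iso_def)
  have Mod_group: "group (K Mod N)" by (rule factorgroup_is_group)
  define h where "h = (\<lambda>A. \<psi> (N #>\<^bsub>K\<^esub> A))"
  have coset: "N #>\<^bsub>K\<^esub> A \<in> carrier (K Mod N)" if "A \<in> S" for A
    using that by (auto simp: FactGroup_def RCOSETS_def K)
  have "h ` S = carrier G"
  proof -
    have "carrier (K Mod N) = (\<lambda>A. N #>\<^bsub>K\<^esub> A) ` S"
      by (auto simp: FactGroup_def RCOSETS_def K)
    then show ?thesis using \<psi>_bij by (simp add: bij_betw_def h_def image_image)
  qed
  moreover have "h (A ** B) = h A \<otimes>\<^bsub>G\<^esub> h B" if "A \<in> S" "B \<in> S" for A B
    using hom_mult[OF \<psi>_hom coset coset] hom_mult[OF r_coset_hom_Mod, of A B] that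
    by (simp add: h_def K)
  moreover have "h A = \<one>\<^bsub>G\<^esub> \<longleftrightarrow> scalar A" if A: "A \<in> S" for A
  proof -
    have "\<psi> \<one>\<^bsub>K Mod N\<^esub> = \<one>\<^bsub>G\<^esub>" using \<psi>_hom Mod_group G by (rule hom_one)
    moreover have "\<one>\<^bsub>K Mod N\<^esub> \<in> carrier (K Mod N)" 
      by (rule monoid.one_closed[OF group.is_monoid[OF Mod_group]])
    ultimately have "h A = \<one>\<^bsub>G\<^esub> \<longleftrightarrow> N #>\<^bsub>K\<^esub> A = \<one>\<^bsub>K Mod N\<^esub>"
      using inj_onD[OF bij_betw_imp_inj_on[OF \<psi>_bij]] coset[OF A] unfolding h_def by metis
    also have "\<dots> \<longleftrightarrow> N #>\<^bsub>K\<^esub> A = N" by (simp add: FactGroup_def)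
    also have "\<dots> \<longleftrightarrow> A \<in> N"
    proof
      have "A \<in> carrier K" using A by (simp add: K)
      then have "A \<in> N #>\<^bsub>K\<^esub> A" by (rule group.rcos_self[OF K_group _ subgroup_axioms])
      then show "N #>\<^bsub>K\<^esub> A = N \<Longrightarrow> A \<in> N" by simp
    qed (rule rcos_const[OF K_group])
    finally show ?thesis using A by (simp add: N)
  qed
  ultimately show ?thesis by blast
qed

lemma power_commuting_exponents: "((a :: 'a :: monoid_mult) ^ m) ^ n = (a ^ n) ^ m"
  by (simp add: mult.commute flip: power_mult)

section \<open>Automorphisms of PSL(2, q) and PGL(2, q) acting on trace invariants\<close>

locale Galois_field =
  fixes p e q :: nat and F :: "'a :: alg_closed_field set"
  assumes p: "prime p" "odd p" "CHAR('a) = p" and e: "e \<ge> 1" and q: "q = p ^ e"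
    and F_GF: "F = GF q"

sublocale Galois_field \<subseteq> finite_subfield F
  unfolding F_GF by (rule finite_subfield_GF[OF p(1,3) e q])

context Galois_field
begin

lemma F_eq: "F = {x. x ^ q = x}"
  by (simp add: F_GF GF_def)

lemma exists_matrix_group_onto:
  assumes G: "group G" and iso: "G \<cong> PSL2 F \<or> G \<cong> PGL2 F"
  shows "\<exists>S h. projective_rep F q S \<and> h ` S = carrier G \<and>
    (\<forall>A\<in>S. \<forall>B\<in>S. h (A ** B) = h A \<otimes>\<^bsub>G\<^esub> h B) \<and> (\<forall>A\<in>S. h A = \<one>\<^bsub>G\<^esub> \<longleftrightarrow> scalar A)"
proof -
  have entries: "(\<forall>i j. (A ** B) $ i $ j \<in> F)"
    if "\<forall>i j. A $ i $ j \<in> F" "\<forall>i j. B $ i $ j \<in> F" for A B :: "'a ^ 2 ^ 2"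
    using that by (simp add: matrix_matrix_mult_def sum_2 add mult)
  have adj_entries: "(\<forall>i j. adj A $ i $ j \<in> F)" if "\<forall>i j. A $ i $ j \<in> F" for A :: "'a ^ 2 ^ 2"
    using that by (simp add: adj_def forall_2 uminus)
  have det_F: "det A \<in> F" if "\<forall>i j. A $ i $ j \<in> F" for A :: "'a ^ 2 ^ 2"
    using that by (simp add: det_2 diff mult)
  have mat_entries: "(\<forall>i j. (mat c :: 'a ^ 2 ^ 2) $ i $ j \<in> F) \<longleftrightarrow> c \<in> F" for c
    by (auto simp: mat_eq_mat2 forall_2 zero)
  have mat2_entries: "(\<forall>i j. mat2 a b c d $ i $ j \<in> F) \<longleftrightarrow> a \<in> F \<and> b \<in> F \<and> c \<in> F \<and> d \<in> F" for a b c d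
    by (auto simp: forall_2)
  define S1 where "S1 = {A :: 'a ^ 2 ^ 2. (\<forall>i j. A $ i $ j \<in> F) \<and> det A = 1}"
  define S2 where "S2 = {A :: 'a ^ 2 ^ 2. (\<forall>i j. A $ i $ j \<in> F) \<and> det A \<noteq> 0}"
  from iso show ?thesis
  proof
    assume iso: "G \<cong> PSL2 F"
    have "projective_rep F q S1"
      by (intro projective_rep.intro projective_rep_axioms.intro finite_subfield_axioms F_eq)
        (use p entries in \<open>auto simp: S1_def det_mul mat2_entries\<close>)
    moreover have "\<exists>h. h ` S1 = carrier G \<and> (\<forall>A\<in>S1. \<forall>B\<in>S1. h (A ** B) = h A \<otimes>\<^bsub>G\<^esub> h B) \<and>
      (\<forall>A\<in>S1. h A = \<one>\<^bsub>G\<^esub> \<longleftrightarrow> scalar A)"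
    proof (rule scalar_quotient_iso_hom[where K = "SL2 F" and N = "{mat 1, mat (- 1)}"])
      show "mat 1 \<in> S1" by (simp add: S1_def mat_entries one)
      show "A ** B \<in> S1" if "A \<in> S1" "B \<in> S1" for A B
        using that entries by (simp add: S1_def det_mul)
      show "\<exists>B\<in>S1. B ** A = mat 1" if "A \<in> S1" for A
        by (rule bexI[of _ "adj A"]) (use that adj_entries in \<open>auto simp: S1_def adj_mult\<close>)
      show "SL2 F = \<lparr>carrier = S1, mult = (**), one = mat 1\<rparr>" by (simp add: SL2_def S1_def)
      show "{mat 1, mat (- 1)} = {A \<in> S1. scalar A}"
        using mat_entries[of 1] mat_entries[of "- 1"]
        by (auto simp: S1_def scalar_def one uminus power2_eq_1_iff)
      show "G \<cong> SL2 F Mod {mat 1, mat (- 1)}" using iso by (simp add: PSL2_def)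
    qed (fact G)
    ultimately show ?thesis by blast
  next
    assume iso: "G \<cong> PGL2 F"
    have "projective_rep F q S2"
      by (intro projective_rep.intro projective_rep_axioms.intro finite_subfield_axioms F_eq)
        (use p entries in \<open>auto simp: S2_def det_mul mat2_entries\<close>)
    moreover have "\<exists>h. h ` S2 = carrier G \<and> (\<forall>A\<in>S2. \<forall>B\<in>S2. h (A ** B) = h A \<otimes>\<^bsub>G\<^esub> h B) \<and>
      (\<forall>A\<in>S2. h A = \<one>\<^bsub>G\<^esub> \<longleftrightarrow> scalar A)"
    proof (rule scalar_quotient_iso_hom[where K = "GL2 F" and N = "{mat c | c. c \<in> F \<and> c \<noteq> 0}"])
      show "mat 1 \<in> S2" by (simp add: S2_def mat_entries one)
      show "A ** B \<in> S2" if "A \<in> S2" "B \<in> S2" for A B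
        using that entries by (simp add: S2_def det_mul)
      show "\<exists>B\<in>S2. B ** A = mat 1" if "A \<in> S2" for A
      proof (rule bexI[of _ "mat (1 / det A) ** adj A"])
        have "1 / det A \<in> F" using that det_F[of A] by (auto simp: S2_def intro: divide one)
        then show "mat (1 / det A) ** adj A \<in> S2"
          using that entries adj_entries mat_entries by (simp add: S2_def det_mul)
        show "mat (1 / det A) ** adj A ** A = mat 1"
          using that by (simp add: S2_def adj_mult mat_mult_mat flip: matrix_mul_assoc)
      qed
      show "GL2 F = \<lparr>carrier = S2, mult = (**), one = mat 1\<rparr>" by (simp add: GL2_def S2_def)
      show "{mat c | c. c \<in> F \<and> c \<noteq> 0} = {A \<in> S2. scalar A}"
      proof safe
        fix c assume "c \<in> F" "c \<noteq> 0"
        then show "mat c \<in> S2" using mat_entries[of c] by (simp add: S2_def)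
      next
        fix A assume "A \<in> S2" "scalar A"
        then show "\<exists>c. A = mat c \<and> c \<in> F \<and> c \<noteq> 0"
          using mat_entries by (auto simp: S2_def scalar_def)
      qed simp
      show "G \<cong> GL2 F Mod {mat c | c. c \<in> F \<and> c \<noteq> 0}" using iso by (simp add: PGL2_def)
    qed (fact G)
    ultimately show ?thesis by blast
  qed
qed

text \<open>The \<open>e\<close>-th iterate of Frobenius is the \<open>q\<close>-th power map, which
  is trivial on \<open>F\<close>.\<close>

lemma power_p_mod:
  assumes "x \<in> F"
  shows "x ^ (p ^ n) = x ^ (p ^ (n mod e))"
proof -
  have qk: "x ^ (q ^ k) = x" for k
  proof (induction k)
    case (Suc k)
    have "x ^ (q ^ Suc k) = (x ^ (q ^ k)) ^ q" by (simp add: mult.commute flip: power_mult)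
    then show ?case using Suc assms F_eq by simp
  qed simp
  have "p ^ n = q ^ (n div e) * p ^ (n mod e)"
    unfolding q by (simp flip: power_mult power_add)
  then have "x ^ (p ^ n) = (x ^ (q ^ (n div e))) ^ (p ^ (n mod e))"
    by (simp only: power_mult)
  then show ?thesis by (simp only: qk)
qed

lemma Frobenius_inj: "(x :: 'a) ^ (p ^ n) = y ^ (p ^ n) \<longleftrightarrow> x = y"
proof
  assume *: "x ^ (p ^ n) = y ^ (p ^ n)"
  have "((x - y) + y) ^ (p ^ n) = (x - y) ^ (p ^ n) + y ^ (p ^ n)"
    by (rule freshmans_dream') (use p in auto)
  then show "x = y" using * by simp
qed simp

text \<open>If a Frobenius power with exponent 0 < m < e fixed \<open>F\<close>, then
  \<open>F\<close> with its p^e elements would lie in GF(p^m). So \<open>e\<close> divides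
  \<open>n\<close>; the bound \<open>2 * e\<close> fits the application to \<open>n = 2 * j\<close>
  with \<open>j < e\<close>.\<close>

lemma Frobenius_order:
  assumes fixed: "\<And>x. x \<in> F \<Longrightarrow> x ^ (p ^ n) = x" and "n < 2 * e"
  shows "n = 0 \<or> n = e"
proof -
  have small: "m = 0" if "m < e" "\<And>x. x \<in> F \<Longrightarrow> x ^ (p ^ m) = x" for m
  proof (rule ccontr)
    assume "m \<noteq> 0"
    then have m: "m \<ge> 1" by simp
    interpret m: finite_subfield "GF (p ^ m) :: 'a set"
      by (rule finite_subfield_GF[OF p(1,3) m refl])
    have "card F \<le> card (GF (p ^ m) :: 'a set)"
      by (rule card_mono[OF m.finite]) (use that in \<open>auto simp: GF_def\<close>)
    then have "p ^ e \<le> p ^ m"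
      using card_GF[OF p(1,3) e q] card_GF[OF p(1,3) m refl] F_GF q by simp
    moreover have "p ^ m < p ^ e"
      using \<open>m < e\<close> prime_gt_1_nat[OF p(1)] by (rule power_strict_increasing)
    ultimately show False by simp
  qed
  have "n mod e = 0"
    by (rule small) (use e fixed power_p_mod[of _ n] in auto)
  then show ?thesis using assms(2) e by (auto simp: mod_eq_0_iff_dvd elim!: dvdE)
qed

text \<open>Both \<open>h\<close> and its composite with \<open>\<phi>\<close> represent the same
  matrix group, so each changes \<open>\<tau>\<close> by a Frobenius power. The quotient of these
  powers describes the effect of \<open>\<phi>\<close>.\<close>

theorem automorphism_class_\<tau>:
  assumes G: "group G" "carrier G \<subseteq> carrier (PGL2 UNIV)" "mult G = mult (PGL2 UNIV)"
      "one G = one (PGL2 UNIV)"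
    and iso: "G \<cong> PSL2 F \<or> G \<cong> PGL2 F"
    and \<phi>: "\<phi> \<in> iso G G"
  shows "\<exists>j<e. (\<forall>g\<in>carrier G. class_\<tau> g \<in> F \<and> class_\<tau> (\<phi> g) = class_\<tau> g ^ (p ^ j)) \<and>
    ((\<forall>g\<in>carrier G. \<phi> (\<phi> g) = g) \<longrightarrow> j = 0 \<or> 2 * j = e)"
proof -
  obtain S h where rep: "projective_rep F q S" and h_onto: "h ` S = carrier G"
    and h: "\<forall>A\<in>S. \<forall>B\<in>S. h (A ** B) = h A \<otimes>\<^bsub>G\<^esub> h B" "\<forall>A\<in>S. h A = \<one>\<^bsub>G\<^esub> \<longleftrightarrow> scalar A"
    using exists_matrix_group_onto[OF G(1) iso] by (elim exE conjE) (rule that)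
  note h_mult = h(1)[rule_format] and h_one = h(2)[rule_format]
  interpret projective_rep F q S by (fact rep)
  have \<phi>_hom: "\<phi> \<in> hom G G" and \<phi>_bij: "bij_betw \<phi> (carrier G) (carrier G)"
    using \<phi> by (auto simp: iso_def)
  have h_carrier: "h A \<in> carrier G" if "A \<in> S" for A using h_onto that by blast
  have \<phi>_carrier: "\<phi> g \<in> carrier G" if "g \<in> carrier G" for g
    using \<phi>_bij that by (auto simp: bij_betw_def)
  have \<phi>_one: "\<phi> g = \<one>\<^bsub>G\<^esub> \<longleftrightarrow> g = \<one>\<^bsub>G\<^esub>" if "g \<in> carrier G" for g
    using hom_one[OF \<phi>_hom G(1) G(1)] \<phi>_bij that G(1)
    by (metis bij_betw_def group.is_monoid inj_onD monoid.one_closed)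
  obtain i where i: "\<And>A. A \<in> S \<Longrightarrow> class_\<tau> (h A) = \<tau> A ^ (p ^ i)"
    using class_\<tau>_hom[of h] h_carrier h_mult h_one G p(3) by (auto simp: subset_iff)
  obtain i' where i': "\<And>A. A \<in> S \<Longrightarrow> class_\<tau> (\<phi> (h A)) = \<tau> A ^ (p ^ i')"
    using class_\<tau>_hom[of "\<lambda>A. \<phi> (h A)"] h_carrier \<phi>_carrier h_mult hom_mult[OF \<phi>_hom] h_one \<phi>_one G p(3)
    by (auto simp: subset_iff)
  \<comment> \<open>This is i' - i modulo \<open>e\<close>; the summand \<open>(e - 1) * i\<close>
    stands for -i among the natural numbers.\<close>
  define j where "j = (i' + (e - 1) * i) mod e"
  have ij: "(i + j) mod e = i' mod e"
  proof -
    have "i + (i' + (e - 1) * i) = i' + e * i" using e by (cases e) simp_all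
    then show ?thesis unfolding j_def by (metis mod_add_right_eq mod_mult_self2)
  qed
  have \<tau>_F: "\<tau> A \<in> F" if "A \<in> S" for A
    unfolding \<tau>_def det_2 using S_entries[OF that] by (intro divide power add diff mult) auto
  have j: "class_\<tau> g \<in> F" "class_\<tau> (\<phi> g) = class_\<tau> g ^ (p ^ j)" if g: "g \<in> carrier G" for g
  proof -
    obtain A where A: "A \<in> S" "g = h A" using g h_onto by blast
    show "class_\<tau> g \<in> F" using i A \<tau>_F power by simp
    have "class_\<tau> (\<phi> g) = \<tau> A ^ (p ^ (i + j))"
      using i' A ij power_p_mod[OF \<tau>_F[OF A(1)]] by metis
    then show "class_\<tau> (\<phi> g) = class_\<tau> g ^ (p ^ j)"
      using i A by (simp add: power_add power_mult)
  qed
  moreover have "j < e" using e by (simp add: j_def)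
  moreover have "j = 0 \<or> 2 * j = e" if inv: "\<forall>g\<in>carrier G. \<phi> (\<phi> g) = g"
  proof -
    have square: "(x\<^sup>2) ^ (p ^ (2 * j)) = x\<^sup>2" if x: "x \<in> F" for x
    proof -
      \<comment> \<open>A companion matrix of determinant 1 and trace \<open>x\<close>: every square
        in \<open>F\<close> is thus a value of \<open>\<tau>\<close>.\<close>
      define A where "A = mat2 x (- 1) 1 0"
      have A: "A \<in> S" unfolding A_def using x by (intro SL2_in_S) (auto simp: one zero uminus)
      have "\<tau> A = x\<^sup>2" by (simp add: A_def)
      have "class_\<tau> (h A) = class_\<tau> (h A) ^ (p ^ j * p ^ j)"
        using j(2)[OF h_carrier[OF A]] j(2)[OF \<phi>_carrier[OF h_carrier[OF A]]] inv h_carrier[OF A]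
        by (simp add: power_mult)
      then have "(x\<^sup>2) ^ (p ^ i) = ((x\<^sup>2) ^ (p ^ i)) ^ (p ^ j * p ^ j)"
        unfolding i[OF A] \<open>\<tau> A = x\<^sup>2\<close> .
      also have "p ^ j * p ^ j = p ^ (2 * j)" by (simp only: mult_2 power_add)
      also have "((x\<^sup>2) ^ (p ^ i)) ^ (p ^ (2 * j)) = ((x\<^sup>2) ^ (p ^ (2 * j))) ^ (p ^ i)"
        by (rule power_commuting_exponents)
      finally have "((x\<^sup>2) ^ (p ^ (2 * j))) ^ (p ^ i) = (x\<^sup>2) ^ (p ^ i)" by (rule sym)
      then show ?thesis by (simp only: Frobenius_inj)
    qed
    have "x ^ (p ^ (2 * j)) = x" if x: "x \<in> F" for x
    proof -
      define r where "r = p ^ (2 * j)"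
      have dream: "(a + b) ^ r = a ^ r + b ^ r" for a b :: 'a
        unfolding r_def by (rule freshmans_dream') (use p in auto)
      \<comment> \<open>Frobenius fixes x^2 and (x + 1)^2, hence also their difference 2x + 1, and
        therefore x because 2 is invertible.\<close>
      have expand: "(x + 1)\<^sup>2 = (x\<^sup>2 + 1) + (x + x)"
        by (simp add: power2_eq_square algebra_simps)
      have "((x + 1)\<^sup>2) ^ r = ((x\<^sup>2) ^ r + 1) + (x ^ r + x ^ r)"
        unfolding expand by (simp only: dream power_one)
      then have "(x + 1)\<^sup>2 = (x\<^sup>2 + 1) + (x ^ r + x ^ r)"
        unfolding r_def square[OF x] square[OF add[OF x one]] .
      then have "(x\<^sup>2 + 1) + (x + x) = (x\<^sup>2 + 1) + (x ^ r + x ^ r)"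
        by (simp only: expand)
      then have "2 * x ^ r = 2 * x" by (simp only: add_left_cancel mult_2)
      then have "x ^ r = x" using two_neq_0 by (simp only: mult_cancel_left) simp
      then show ?thesis by (simp only: r_def)
    qed
    then show ?thesis using Frobenius_order[of "2 * j"] \<open>j < e\<close> by simp
  qed
  ultimately show ?thesis by blast
qed

end

section \<open>Orders and automorphisms of subgroups of \<open>PGL(2, K)\<close>\<close>

lemma scalar_iff_proj_one:
  assumes "det A \<noteq> 0"
  shows "proj A = \<one>\<^bsub>PGL2 UNIV\<^esub> \<longleftrightarrow> scalar A"
proof
  assume "scalar A"
  then obtain c where "A = mat c" by (auto simp: scalar_def)
  with assms show "proj A = \<one>\<^bsub>PGL2 UNIV\<^esub>"
    unfolding proj_one proj_eq_iff by (intro peqI[of c]) auto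
qed (auto simp: proj_one proj_eq_iff peq_def)

lemma proj_mat_mult [simp]: "c \<noteq> 0 \<Longrightarrow> proj (mat c ** A) = proj A"
  by (simp add: proj_eq_iff mat_mult_peq)

text \<open>If \<open>A\<close> has distinct eigenvalues \<open>\<mu>\<close> and \<open>\<nu>\<close>, then
  \<open>(\<mu> - \<nu>) A\<^sup>n = (\<mu>\<^sup>n - \<nu>\<^sup>n) A - (\<mu>\<^sup>n \<nu> - \<mu> \<nu>\<^sup>n)\<close>.\<close>

lemma ord_proj_eigenvalues:
  fixes a b c d \<mu> \<nu> :: "'a :: field"
  assumes trace: "a + d = \<mu> + \<nu>" and det: "a * d - b * c = \<mu> * \<nu>"
    and "\<mu> \<noteq> \<nu>" "\<mu> \<noteq> 0" "\<nu> \<noteq> 0" and nonscalar: "\<not> (b = 0 \<and> c = 0 \<and> a = d)"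
    and m: "\<And>n. \<mu> ^ n = \<nu> ^ n \<longleftrightarrow> m dvd n"
  shows "group.ord (PGL2 UNIV) (proj (mat2 a b c d)) = m"
proof -
  interpret P: group "PGL2 (UNIV :: 'a set)" by (rule group_PGL2_UNIV)
  define A where "A = mat2 a b c d"
  have detA: "det A \<noteq> 0" using det assms by (simp add: A_def)
  define B where "B = (\<lambda>n. let s = \<mu> ^ n - \<nu> ^ n; t = \<mu> ^ n * \<nu> - \<mu> * \<nu> ^ n
    in mat2 (s * a - t) (s * b) (s * c) (s * d - t))"
  have B0: "B 0 = mat (\<mu> - \<nu>)" by (simp add: B_def mat_eq_mat2)
  have B_Suc: "B (Suc n) = B n ** A" for n
  proof -
    have d: "d = \<mu> + \<nu> - a" using trace by (simp add: algebra_simps)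
    have bc: "b * c = a * d - \<mu> * \<nu>" using det by (simp add: algebra_simps)
    define x y where "x = \<mu> ^ n" and "y = \<nu> ^ n"
    have 1: "(\<mu> * x - \<nu> * y) * a - (\<mu> * x * \<nu> - \<mu> * (\<nu> * y)) = ((x - y) * a - (x * \<nu> - \<mu> * y)) * a + (x - y) * (b * c)"
      unfolding bc unfolding d by (simp add: algebra_simps)
    have 2: "(\<mu> * x - \<nu> * y) * b = ((x - y) * a - (x * \<nu> - \<mu> * y)) * b + (x - y) * b * d"
      unfolding d by (simp add: algebra_simps)
    have 3: "(\<mu> * x - \<nu> * y) * c = (x - y) * c * a + ((x - y) * d - (x * \<nu> - \<mu> * y)) * c"
      unfolding d by (simp add: algebra_simps)
    have 4: "(\<mu> * x - \<nu> * y) * d - (\<mu> * x * \<nu> - \<mu> * (\<nu> * y)) = (x - y) * (b * c) + ((x - y) * d - (x * \<nu> - \<mu> * y)) * d"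
      unfolding bc unfolding d by (simp add: algebra_simps)
    show ?thesis
      using 1 2 3 4 by (simp add: B_def A_def Let_def x_def y_def mult.assoc mult.left_commute)
  qed
  have pow: "proj A [^]\<^bsub>PGL2 UNIV\<^esub> n = proj (B n) \<and> det (B n) \<noteq> 0" for n :: nat
  proof (induction n)
    case 0
    have "proj (B 0) = \<one>\<^bsub>PGL2 UNIV\<^esub>"
      by (subst scalar_iff_proj_one) (use assms in \<open>simp_all add: B0\<close>)
    then show ?case using assms by (simp add: B0)
  next
    case (Suc n)
    then show ?case using detA by (simp add: B_Suc proj_mult det_mul)
  qed
  have "proj A [^]\<^bsub>PGL2 UNIV\<^esub> n = \<one>\<^bsub>PGL2 UNIV\<^esub> \<longleftrightarrow> m dvd n" for n :: nat
  proof -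
    have "proj A [^]\<^bsub>PGL2 UNIV\<^esub> n = \<one>\<^bsub>PGL2 UNIV\<^esub> \<longleftrightarrow> scalar (B n)"
      using pow[of n] scalar_iff_proj_one[of "B n"] by simp
    \<comment> \<open>\<open>B n\<close> is a multiple of the nonscalar \<open>A\<close> minus a
      scalar matrix, so it is scalar only if that multiple is zero.\<close>
    also have "\<dots> \<longleftrightarrow> \<mu> ^ n = \<nu> ^ n"
      using nonscalar by (auto simp: B_def Let_def)
    finally show ?thesis using m by simp
  qed
  moreover have "proj A \<in> carrier (PGL2 UNIV)" using detA by (auto simp: carrier_PGL2_UNIV)
  ultimately show ?thesis by (subst P.ord_unique) (auto simp: A_def)
qed

text \<open>The eigenvalues are \<open>\<mu>\<close> and \<open>- \<mu>\<close>, distinct because 2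
  is nonzero, and their ratio -1 has order 2.\<close>

lemma ord_proj_traceless:
  fixes a b c :: "'a :: alg_closed_field"
  assumes "(2 :: 'a) \<noteq> 0" and det: "a * a + b * c \<noteq> 0" and "d = - a"
  shows "group.ord (PGL2 UNIV) (proj (mat2 a b c d)) = 2"
proof -
  obtain \<mu> where \<mu>: "\<mu>\<^sup>2 = a * a + b * c" using nth_root_exists[of 2] by fastforce
  then have "\<mu> \<noteq> 0" using det by auto
  have double: "x = - x \<longleftrightarrow> x = 0" for x :: 'a
  proof -
    have "x = - x \<longleftrightarrow> 2 * x = 0" by (simp only: mult_2 eq_neg_iff_add_eq_0)
    then show ?thesis using assms(1) by simp
  qed
  show ?thesis
  proof (rule ord_proj_eigenvalues[where \<mu> = \<mu> and \<nu> = "- \<mu>"])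
    show "\<mu> ^ n = (- \<mu>) ^ n \<longleftrightarrow> 2 dvd n" for n
      by (cases "even n") (use \<open>\<mu> \<noteq> 0\<close> double in auto)
    show "a * d - b * c = \<mu> * - \<mu>" using \<mu> assms by (simp add: power2_eq_square)
    show "\<not> (b = 0 \<and> c = 0 \<and> a = d)" using assms double[of a] by auto
  qed (use \<open>\<mu> \<noteq> 0\<close> double assms in auto)
qed

lemma (in group) ord_subgroup_generated:
  "group.ord (subgroup_generated G S) x = ord x"
  by (simp add: group.ord_def[OF group_subgroup_generated] ord_def pow_subgroup_generated)

lemma (in group) carrier_subgroup_generated_eq_generate:
  assumes "S \<subseteq> carrier G"
  shows "carrier (subgroup_generated G S) = generate (subgroup_generated G S) S"
proof -
  have "generate G S = generate (G\<lparr>carrier := generate G S\<rparr>) S"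
    by (rule generate_consistent[symmetric])
      (use generate_is_subgroup[OF assms] in \<open>auto intro: generate.incl\<close>)
  then show ?thesis using assms by (simp add: subgroup_generated_def Int_absorb1)
qed

text \<open>The elements that \<open>\<Phi>\<close> keeps in the subgroup and returns to themselves
  after two steps form a subgroup containing the generators. A map that is its own inverse is
  bijective.\<close>

lemma (in group) involutive_automorphism_subgroup_generated:
  assumes hom: "\<Phi> \<in> hom G G" and S: "S \<subseteq> carrier G"
    and gens: "\<And>x. x \<in> S \<Longrightarrow> \<Phi> x \<in> carrier (subgroup_generated G S) \<and> \<Phi> (\<Phi> x) = x"
  shows "\<Phi> \<in> iso (subgroup_generated G S) (subgroup_generated G S) \<and>
    (\<forall>x\<in>carrier (subgroup_generated G S). \<Phi> (\<Phi> x) = x)"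
proof -
  let ?H = "carrier (subgroup_generated G S)"
  define K where "K = {x \<in> ?H. \<Phi> x \<in> ?H \<and> \<Phi> (\<Phi> x) = x}"
  have H: "subgroup ?H G" by (rule subgroup_subgroup_generated)
  have HG: "x \<in> carrier G" if "x \<in> ?H" for x using H that by (rule subgroup.mem_carrier)
  interpret \<Phi>: group_hom G G \<Phi> by unfold_locales (rule hom)
  have "subgroup K G"
  proof (rule subgroupI)
    have "\<one> \<in> K" using H by (simp add: K_def subgroup.one_closed)
    then show "K \<noteq> {}" by blast
    show "K \<subseteq> carrier G" using HG by (auto simp: K_def)
    show "inv x \<in> K" if "x \<in> K" for x
      using that HG H by (auto simp: K_def intro: subgroup.m_inv_closed)
    show "x \<otimes> y \<in> K" if "x \<in> K" "y \<in> K" for x y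
      using that HG H by (auto simp: K_def intro: subgroup.m_closed)
  qed
  moreover have "S \<subseteq> K"
    using gens subgroup_generated_subset_carrier_subset[OF S] by (auto simp: K_def)
  ultimately have "?H \<subseteq> K" by (rule subgroup_generated_minimal)
  then have K: "\<Phi> x \<in> ?H" "\<Phi> (\<Phi> x) = x" if "x \<in> ?H" for x using that by (auto simp: K_def)
  moreover have "bij_betw \<Phi> ?H ?H"
    by (rule bij_betw_byWitness[where f' = \<Phi>]) (use K in auto)
  moreover have "\<Phi> \<in> hom (subgroup_generated G S) (subgroup_generated G S)"
    by (rule homI) (use K HG in auto)
  ultimately show ?thesis by (simp add: iso_def)
qed

text \<open>Applying \<open>f\<close> entrywise turns a scalar factor \<open>c\<close> into
  \<open>f c\<close>, so the map descends to PGL(2, K), as does conjugation by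
  \<open>C\<close>.\<close>

lemma exists_semilinear_hom:
  fixes C :: "'a :: field ^ 2 ^ 2"
  assumes f_mult: "\<And>x y. f (x * y) = f x * f y" and f_add: "\<And>x y. f (x + y) = f x + f y"
    and f_eq_0: "\<And>x. f x = 0 \<longleftrightarrow> x = 0" and C: "det C \<noteq> 0"
  shows "\<exists>\<Phi>\<in>hom (PGL2 UNIV) (PGL2 UNIV). \<forall>A. \<Phi> (proj A) = proj (C ** map_mat f A ** adj C)"
proof -
  define \<Psi> where "\<Psi> = (\<lambda>A. C ** map_mat f A ** adj C)"
  define \<Phi> where "\<Phi> = (\<lambda>g. proj (\<Psi> (SOME A. A \<in> g)))"
  have \<Psi>_peq: "\<Psi> A \<propto> \<Psi> B" if "A \<propto> B" for A B
  proof -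
    obtain c where c: "c \<noteq> 0" "A = mat c ** B"
      using \<open>A \<propto> B\<close> by (auto simp: peq_def)
    have "map_mat f A = mat (f c) ** map_mat f B"
      unfolding c by (cases B rule: mat2_exhaust) (simp add: mat_eq_mat2 f_mult)
    then have "map_mat f A \<propto> map_mat f B" using c f_eq_0 by (auto simp: mat_mult_peq)
    then show ?thesis unfolding \<Psi>_def by (intro peq_mult peq_refl)
  qed
  have \<Phi>: "\<Phi> (proj A) = proj (\<Psi> A)" for A
  proof -
    have "A \<in> proj A" unfolding proj_eq by (auto intro!: exI[of _ 1])
    then have "(SOME B. B \<in> proj A) \<in> proj A" by (rule someI)
    then have "(SOME B. B \<in> proj A) \<propto> A" by (auto simp: proj_eq peq_def)
    then show ?thesis unfolding \<Phi>_def proj_eq_iff by (rule \<Psi>_peq)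
  qed
  have f_diff: "f (x - y) = f x - f y" for x y using f_add[of "x - y" y] by simp
  have \<Psi>_det: "det (\<Psi> A) \<noteq> 0" if "det A \<noteq> 0" for A
  proof -
    have "det (map_mat f A) = f (det A)"
      by (cases A rule: mat2_exhaust) (simp add: f_diff f_mult)
    then show ?thesis using that C f_eq_0 by (simp add: \<Psi>_def det_mul)
  qed
  have \<Psi>_mult: "\<Psi> (A ** B) \<propto> \<Psi> A ** \<Psi> B" for A B
  proof -
    have "adj (adj C) = C" by (cases C rule: mat2_exhaust) simp
    then show ?thesis
      using conj_mult_peq[of "adj C" "map_mat f A" "map_mat f B"] C
      by (simp add: \<Psi>_def map_mat_mult[OF f_mult f_add])
  qed
  have "\<Phi> \<in> hom (PGL2 UNIV) (PGL2 UNIV)"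
  proof (rule homI)
    fix g h :: "('a ^ 2 ^ 2) set" assume "g \<in> carrier (PGL2 UNIV)" "h \<in> carrier (PGL2 UNIV)"
    then obtain A B where AB: "g = proj A" "det A \<noteq> 0" "h = proj B" "det B \<noteq> 0"
      by (auto simp: carrier_PGL2_UNIV)
    show "\<Phi> g \<in> carrier (PGL2 UNIV)" using AB \<Psi>_det by (auto simp: \<Phi> carrier_PGL2_UNIV)
    show "\<Phi> (g \<otimes>\<^bsub>PGL2 UNIV\<^esub> h) = \<Phi> g \<otimes>\<^bsub>PGL2 UNIV\<^esub> \<Phi> h"
      using AB \<Psi>_det \<Psi>_mult by (simp add: \<Phi> proj_mult proj_eq_iff)
  qed
  then show ?thesis using \<Phi> unfolding \<Psi>_def by blast
qed

section \<open>The generating triple\<close>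

lemma primitive_root_of_unity_power_eq_1_iff:
  assumes "primitive_root_of_unity N x"
  shows "x ^ n = 1 \<longleftrightarrow> N dvd n"
proof
  assume "x ^ n = 1"
  have N: "N > 0" "x ^ N = 1" "\<And>m. 0 < m \<Longrightarrow> m < N \<Longrightarrow> x ^ m \<noteq> 1"
    using assms by (auto simp: primitive_root_of_unity_def)
  have "x ^ n = (x ^ N) ^ (n div N) * x ^ (n mod N)"
    by (simp flip: power_mult power_add)
  then have "x ^ (n mod N) = 1" using \<open>x ^ n = 1\<close> N by simp
  then have "n mod N = 0" using N(3)[of "n mod N"] N(1) by (cases "n mod N = 0") auto
  then show "N dvd n" by auto
qed (use assms in \<open>auto simp: primitive_root_of_unity_def power_mult\<close>)

text \<open>Here \<open>\<xi>\<close>, \<open>\<zeta>\<close>, \<open>\<omega>\<close> stand for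
  \<open>\<xi>\<^sub>k\<close>, \<open>\<xi>\<^sub>l\<close>, \<open>\<omega>\<^sub>l\<close>. The
  form of \<open>D\<close> uses
  \<open>\<omega>\<^sub>k\<^sup>2 - 4 = \<delta>\<^sup>2\<close>.\<close>

locale generating_triple =
  fixes k l :: nat and \<xi> \<zeta> \<delta> \<omega> D :: "'a :: alg_closed_field"
  assumes kl: "k \<ge> 3" "l \<ge> 3" and two: "(2 :: 'a) \<noteq> 0"
    and \<xi>: "primitive_root_of_unity (2 * k) \<xi>" and \<zeta>: "primitive_root_of_unity (2 * l) \<zeta>"
    and \<delta>: "\<delta> = \<xi> - inverse \<xi>" and \<omega>: "\<omega> = \<zeta> + inverse \<zeta>"
    and D: "D = \<delta>\<^sup>2 + \<omega>\<^sup>2" and D_nz: "D \<noteq> 0"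
begin

text \<open>The prefactors \<open>\<eta>\<close> and \<open>\<beta>\<close> are dropped, as they do
  not change the classes in PGL(2, K).\<close>

definition "X\<^sub>0 = mat2 D (D * \<omega> * \<xi>) (- \<omega> * inverse \<xi>) (- D)"
definition "Y\<^sub>0 = mat2 0 (\<xi> * D) (inverse \<xi>) 0"
definition "Z\<^sub>0 = mat2 0 D 1 0"

abbreviation "X \<equiv> proj X\<^sub>0"
abbreviation "Y \<equiv> proj Y\<^sub>0"
abbreviation "Z \<equiv> proj Z\<^sub>0"
abbreviation "P \<equiv> PGL2 (UNIV :: 'a set)"
abbreviation "G \<equiv> subgroup_generated P {X, Y, Z}"

lemma \<xi>_nz [simp]: "\<xi> \<noteq> 0" and \<zeta>_nz [simp]: "\<zeta> \<noteq> 0"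
  using \<xi> \<zeta> by (auto simp: primitive_root_of_unity_def power_0_left split: if_splits)

lemma \<xi>_power: "\<xi> ^ (2 * n) = 1 \<longleftrightarrow> k dvd n" and \<zeta>_power: "\<zeta> ^ (2 * n) = 1 \<longleftrightarrow> l dvd n"
  using primitive_root_of_unity_power_eq_1_iff[OF \<xi>] primitive_root_of_unity_power_eq_1_iff[OF \<zeta>]
  by auto

lemma \<delta>_nz: "\<delta> \<noteq> 0"
proof
  assume "\<delta> = 0"
  then have "\<xi> ^ (2 * 1) = 1"
    using right_inverse[OF \<xi>_nz] by (simp add: \<delta> power2_eq_square)
  then show False using \<xi>_power[of 1] kl by simp
qed

lemma power_eq_power_inverse_iff: "x \<noteq> 0 \<Longrightarrow> x ^ n = inverse x ^ n \<longleftrightarrow> x ^ (2 * n) = 1" for x :: 'a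
  by (simp add: power_inverse inverse_eq_divide nonzero_eq_divide_eq mult_2 power_add power_divide)

lemma \<zeta>_neq_inverse: "\<zeta> \<noteq> inverse \<zeta>"
  using power_eq_power_inverse_iff[of \<zeta> 1] \<zeta>_power[of 1] kl by simp

lemma \<xi>_neq_inverse: "\<xi> \<noteq> inverse \<xi>"
  using \<delta>_nz \<delta> by simp

lemma products:
  "X\<^sub>0 ** Y\<^sub>0 = mat2 (D * \<omega>) (\<xi> * D\<^sup>2) (- D * inverse \<xi>) (- (D * \<omega>))"
  "Y\<^sub>0 ** Z\<^sub>0 = mat2 (\<xi> * D) 0 0 (inverse \<xi> * D)"
  "Z\<^sub>0 ** X\<^sub>0 = mat2 (- (\<omega> * D * inverse \<xi>)) (- D\<^sup>2) D (D * \<omega> * \<xi>)"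
  "Z\<^sub>0 ** (X\<^sub>0 ** Y\<^sub>0) = mat2 (- D\<^sup>2 * inverse \<xi>) (- \<omega> * D\<^sup>2) (D * \<omega>) (\<xi> * D\<^sup>2)"
  "Y\<^sub>0 ** Y\<^sub>0 = mat D"
  by (simp_all add: X\<^sub>0_def Y\<^sub>0_def Z\<^sub>0_def power2_eq_square mat_eq_mat2 algebra_simps)

lemma det: "det X\<^sub>0 = - D * \<delta>\<^sup>2" "det Y\<^sub>0 = - D" "det Z\<^sub>0 = - D"
  by (simp_all add: X\<^sub>0_def Y\<^sub>0_def Z\<^sub>0_def) (simp add: D power2_eq_square algebra_simps)

lemma det_nz: "det X\<^sub>0 \<noteq> 0" "det Y\<^sub>0 \<noteq> 0" "det Z\<^sub>0 \<noteq> 0"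
  using D_nz \<delta>_nz by (simp_all add: det)

lemma proj_products:
  "X \<otimes>\<^bsub>P\<^esub> Y = proj (X\<^sub>0 ** Y\<^sub>0)" "Y \<otimes>\<^bsub>P\<^esub> Z = proj (Y\<^sub>0 ** Z\<^sub>0)"
  "Z \<otimes>\<^bsub>P\<^esub> X = proj (Z\<^sub>0 ** X\<^sub>0)" "Z \<otimes>\<^bsub>P\<^esub> (X \<otimes>\<^bsub>P\<^esub> Y) = proj (Z\<^sub>0 ** (X\<^sub>0 ** Y\<^sub>0))"
  using det_nz by (simp_all add: proj_mult det_mul)

lemma XYZ_carrier: "{X, Y, Z} \<subseteq> carrier P"
  using det_nz by (auto simp: carrier_PGL2_UNIV)

lemma \<tau>_products:
  "\<tau> (Y\<^sub>0 ** Z\<^sub>0) = (\<xi> + inverse \<xi>)\<^sup>2" "\<tau> (Z\<^sub>0 ** X\<^sub>0) = \<omega>\<^sup>2" "\<tau> (Z\<^sub>0 ** (X\<^sub>0 ** Y\<^sub>0)) = - D"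
proof -
  have "\<tau> (Y\<^sub>0 ** Z\<^sub>0) = (D * (\<xi> + inverse \<xi>))\<^sup>2 / D\<^sup>2"
    unfolding products \<tau>_mat2 by (simp add: algebra_simps power2_eq_square)
  then show "\<tau> (Y\<^sub>0 ** Z\<^sub>0) = (\<xi> + inverse \<xi>)\<^sup>2"
    using D_nz by (simp add: power_mult_distrib)
  have "(- (\<omega> * D * inverse \<xi>) + D * \<omega> * \<xi>) = D * \<omega> * \<delta>"
    by (simp add: \<delta> algebra_simps)
  moreover have "det (Z\<^sub>0 ** X\<^sub>0) = (D * \<delta>)\<^sup>2"
    unfolding det_mul det by (simp add: power2_eq_square)
  ultimately have "\<tau> (Z\<^sub>0 ** X\<^sub>0) = (D * \<omega> * \<delta>)\<^sup>2 / (D * \<delta>)\<^sup>2"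
    by (simp add: \<tau>_def) (simp add: products)
  then show "\<tau> (Z\<^sub>0 ** X\<^sub>0) = \<omega>\<^sup>2"
    using D_nz \<delta>_nz by (simp add: power_mult_distrib)
  have trace: "(Z\<^sub>0 ** (X\<^sub>0 ** Y\<^sub>0)) $ 1 $ 1 + (Z\<^sub>0 ** (X\<^sub>0 ** Y\<^sub>0)) $ 2 $ 2 = D\<^sup>2 * \<delta>"
    unfolding products(4) by (simp add: \<delta> algebra_simps)
  have "det (Z\<^sub>0 ** (X\<^sub>0 ** Y\<^sub>0)) = - (D ^ 3 * \<delta>\<^sup>2)"
    unfolding det_mul det by (simp add: power2_eq_square power3_eq_cube)
  then have "\<tau> (Z\<^sub>0 ** (X\<^sub>0 ** Y\<^sub>0)) = (D\<^sup>2 * \<delta>)\<^sup>2 / - (D ^ 3 * \<delta>\<^sup>2)"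
    unfolding \<tau>_def trace by simp
  then show "\<tau> (Z\<^sub>0 ** (X\<^sub>0 ** Y\<^sub>0)) = - D"
    using D_nz \<delta>_nz by (simp add: power2_eq_square power3_eq_cube)
qed

text \<open>The involutions are traceless. The eigenvalue ratios of YZ and ZX are the squares of
  \<open>\<xi>\<close> and \<open>\<zeta>\<close>, which have orders \<open>k\<close> and
  \<open>l\<close>.\<close>

lemma regular_map: "regular_map k l G X Y Z"
proof -
  interpret P: group P by (rule group_PGL2_UNIV)
  have "P.ord X = 2"
    unfolding X\<^sub>0_def using det_nz(1)
    by (intro ord_proj_traceless two) (auto simp: X\<^sub>0_def)
  moreover have "P.ord Y = 2" "P.ord Z = 2"
    unfolding Y\<^sub>0_def Z\<^sub>0_def using D_nz by (intro ord_proj_traceless two; simp)+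
  moreover have "P.ord (X \<otimes>\<^bsub>P\<^esub> Y) = 2"
  proof -
    have "det (X\<^sub>0 ** Y\<^sub>0) \<noteq> 0" using det_nz by (simp add: det_mul)
    then have "P.ord (proj (X\<^sub>0 ** Y\<^sub>0)) = 2"
      unfolding products by (intro ord_proj_traceless two) auto
    then show ?thesis by (simp add: proj_products)
  qed
  moreover have "P.ord (Y \<otimes>\<^bsub>P\<^esub> Z) = k"
    unfolding proj_products products
  proof (rule ord_proj_eigenvalues[where \<mu> = "\<xi> * D" and \<nu> = "inverse \<xi> * D"])
    show "(\<xi> * D) ^ n = (inverse \<xi> * D) ^ n \<longleftrightarrow> k dvd n" for n
      using D_nz power_eq_power_inverse_iff[of \<xi> n] \<xi>_power[of n] by (simp add: power_mult_distrib)
  qed (use D_nz \<xi>_neq_inverse in auto)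
  moreover have "P.ord (Z \<otimes>\<^bsub>P\<^esub> X) = l"
    unfolding proj_products products
  proof (rule ord_proj_eigenvalues[where \<mu> = "D * \<delta> * \<zeta>" and \<nu> = "D * \<delta> * inverse \<zeta>"])
    show "(D * \<delta> * \<zeta>) ^ n = (D * \<delta> * inverse \<zeta>) ^ n \<longleftrightarrow> l dvd n" for n
      using D_nz \<delta>_nz power_eq_power_inverse_iff[of \<zeta> n] \<zeta>_power[of n] by (simp add: power_mult_distrib)
    show "- (\<omega> * D * inverse \<xi>) + D * \<omega> * \<xi> = D * \<delta> * \<zeta> + D * \<delta> * inverse \<zeta>"
      by (simp add: \<delta> \<omega> algebra_simps)
    have "det (Z\<^sub>0 ** X\<^sub>0) = (D * \<delta>)\<^sup>2"
      unfolding det_mul det by (simp add: power2_eq_square)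
    then show "- (\<omega> * D * inverse \<xi>) * (D * \<omega> * \<xi>) - - D\<^sup>2 * D = D * \<delta> * \<zeta> * (D * \<delta> * inverse \<zeta>)"
      unfolding products by (simp add: power2_eq_square)
  qed (use D_nz \<delta>_nz \<zeta>_neq_inverse in auto)
  ultimately show ?thesis
    using P.carrier_subgroup_generated_eq_generate[OF XYZ_carrier]
      P.subgroup_generated_subset_carrier_subset[OF XYZ_carrier]
    by (simp add: regular_map_def P.ord_subgroup_generated)
qed

section \<open>The divisibility condition on k and the construction of the duality\<close>

text \<open>The divisibility makes the power of \<open>\<xi>\<close> with exponent r - 1 or r + 1
  square to 1, so it is a sign \<open>\<epsilon>\<close>. The two cases lead to a diagonal and an
  antidiagonal conjugating matrix.\<close>

lemma \<xi>_power_cases: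
  assumes "r > 0" "k dvd r + 1 \<or> k dvd r - 1"
  obtains \<epsilon> where "\<epsilon> * \<epsilon> = 1" "\<xi> ^ r = \<epsilon> * \<xi>" | \<epsilon> where "\<epsilon> * \<epsilon> = 1" "\<xi> ^ r = \<epsilon> * inverse \<xi>"
proof (cases "k dvd r + 1")
  case True
  have "\<xi> ^ (2 * (r + 1)) = 1" using True \<xi>_power by blast
  then have "(\<xi> ^ r * \<xi>) * (\<xi> ^ r * \<xi>) = 1"
    unfolding power_even_eq by (simp add: power2_eq_square mult.commute)
  then show ?thesis by (intro that(2)[of "\<xi> ^ r * \<xi>"]) auto
next
  case False
  then obtain m where m: "r = Suc m" "k dvd m" using assms by (cases r) auto
  then have "\<xi> ^ (2 * m) = 1" using \<xi>_power by blast
  then have "\<xi> ^ m * \<xi> ^ m = 1" by (simp add: mult_2 power_add)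
  then show ?thesis using m by (intro that(1)[of "\<xi> ^ m"]) auto
qed

text \<open>For x = \<open>\<xi> ^ r\<close>, clearing denominators in the difference of the two
  squared traces gives a product that vanishes only if \<open>\<xi>\<close> to the power 2(r + 1) or
  2(r - 1) is 1.\<close>

lemma divides_if_trace_fixed:
  assumes r: "r > 0" and dream: "\<And>x y :: 'a. (x + y) ^ r = x ^ r + y ^ r"
    and fixed: "((\<xi> + inverse \<xi>)\<^sup>2) ^ r = (\<xi> + inverse \<xi>)\<^sup>2"
  shows "k dvd r + 1 \<or> k dvd r - 1"
proof -
  define x where "x = \<xi> ^ r"
  have x: "x \<noteq> 0" by (simp add: x_def)
  have "((\<xi> + inverse \<xi>)\<^sup>2) ^ r = ((\<xi> + inverse \<xi>) ^ r)\<^sup>2"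
    by (rule power_commuting_exponents)
  also have "\<dots> = (x + inverse x)\<^sup>2" by (simp add: dream x_def power_inverse)
  finally have "(x + inverse x)\<^sup>2 = (\<xi> + inverse \<xi>)\<^sup>2" using fixed by simp
  then have eq: "((x + inverse x)\<^sup>2 - (\<xi> + inverse \<xi>)\<^sup>2) * (x\<^sup>2 * \<xi>\<^sup>2) = 0" by simp
  have "((x + inverse x)\<^sup>2 - (\<xi> + inverse \<xi>)\<^sup>2) * (x\<^sup>2 * \<xi>\<^sup>2) = (x\<^sup>2 * \<xi>\<^sup>2 - 1) * (x\<^sup>2 - \<xi>\<^sup>2)"
    using x by (simp add: field_simps power2_eq_square)
  with eq have "x\<^sup>2 * \<xi>\<^sup>2 = 1 \<or> x\<^sup>2 = \<xi>\<^sup>2" by auto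
  then show ?thesis
  proof
    assume "x\<^sup>2 * \<xi>\<^sup>2 = 1"
    then have "\<xi> ^ (2 * (r + 1)) = 1"
      unfolding power_even_eq by (simp add: x_def power_mult_distrib mult.commute)
    then show ?thesis using \<xi>_power by blast
  next
    assume "x\<^sup>2 = \<xi>\<^sup>2"
    moreover obtain m where m: "r = Suc m" using r by (cases r) auto
    ultimately have "\<xi>\<^sup>2 * \<xi> ^ (2 * m) = \<xi>\<^sup>2 * 1"
      by (simp add: x_def power_mult_distrib mult.commute flip: power_mult)
    then have "\<xi> ^ (2 * m) = 1" by (simp only: mult_cancel_left) simp
    then show ?thesis using \<xi>_power m by auto
  qed
qed

text \<open>Both conditions of the criterion are instances: \<open>r = 1\<close> for the first, r^2
  = q for the second. The r-th power map exchanges \<open>\<omega>\<^sup>2\<close> and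
  \<open>- D\<close>, the invariants of ZX and ZXY, and a suitable \<open>C\<close> makes it act on
  the triple as required.\<close>

lemma self_Petrie_dual_if:
  assumes r: "r > 0" "odd r" and dream: "\<And>x y :: 'a. (x + y) ^ r = x ^ r + y ^ r"
    and \<omega>_r: "\<omega> ^ (2 * r) = - D" and D_r: "D ^ r = - \<omega>\<^sup>2"
    and k: "k dvd r + 1 \<or> k dvd r - 1"
  shows "self_Petrie_dual G X Y Z"
proof -
  interpret P: group P by (rule group_PGL2_UNIV)
  define f :: "'a \<Rightarrow> 'a" where "f = (\<lambda>x. x ^ r)"
  define v where "v = \<omega> ^ r"
  have vv: "v * v = - D" using \<omega>_r by (simp add: v_def mult_2 power_add)
  then have "v \<noteq> 0" using D_nz by auto
  then have \<omega>_nz: "\<omega> \<noteq> 0" using r by (auto simp: v_def power_0_left)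
  have f_mult: "f (x * y) = f x * f y" for x y by (simp add: f_def power_mult_distrib)
  have f_add: "f (x + y) = f x + f y" for x y unfolding f_def by (rule dream)
  have f_simps: "f 0 = 0" "f 1 = 1" "f (- x) = - f x" "f \<omega> = v" "f D = - (\<omega> * \<omega>)"
    "f (inverse x) = inverse (f x)" for x
    using r D_r by (simp_all add: f_def v_def power_inverse power2_eq_square power_0_left)
  have f_eq_0: "f x = 0 \<longleftrightarrow> x = 0" for x using r by (simp add: f_def)
  have D_eq: "D = - (v * v)" using vv by simp
  note nz = \<omega>_nz \<open>v \<noteq> 0\<close>
  have map_f: "map_mat f X\<^sub>0 = mat2 (- (\<omega> * \<omega>)) (- (\<omega> * \<omega>) * v * f \<xi>) (- v * inverse (f \<xi>)) (\<omega> * \<omega>)"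
    "map_mat f Y\<^sub>0 = mat2 0 (f \<xi> * - (\<omega> * \<omega>)) (inverse (f \<xi>)) 0"
    "map_mat f Z\<^sub>0 = mat2 0 (- (\<omega> * \<omega>)) 1 0"
    by (simp_all add: X\<^sub>0_def Y\<^sub>0_def Z\<^sub>0_def f_mult f_simps)
  have "\<exists>C. det C \<noteq> 0 \<and> C ** map_mat f X\<^sub>0 ** adj C \<propto> X\<^sub>0 ** Y\<^sub>0 \<and>
    C ** map_mat f Y\<^sub>0 ** adj C \<propto> Y\<^sub>0 \<and> C ** map_mat f Z\<^sub>0 ** adj C \<propto> Z\<^sub>0"
    using r(1) k
  proof (cases rule: \<xi>_power_cases)
    case (1 \<epsilon>)
    have f\<xi>: "f \<xi> = \<epsilon> * \<xi>" using 1 by (simp add: f_def)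
    have \<epsilon>: "\<epsilon> = 1 \<or> \<epsilon> = - 1" using 1 by (simp add: square_eq_1_iff)
    \<comment> \<open>A diagonal \<open>C\<close> preserves the class of Z exactly if its ratio of
      diagonal entries squares to \<open>(v / \<omega>)\<^sup>2\<close>; sending X to XY then forces
      the sign \<open>- \<epsilon>\<close>.\<close>
    define C where "C = mat2 (- \<epsilon> * v / \<omega>) 0 0 1"
    have "det C \<noteq> 0" using \<epsilon> nz by (auto simp: C_def)
    moreover have "C ** map_mat f X\<^sub>0 ** adj C \<propto> X\<^sub>0 ** Y\<^sub>0"
      unfolding map_f f\<xi> C_def unfolding products(1) by (rule peqI[of "- \<epsilon> / v"])
        (use \<epsilon> nz in \<open>auto simp: mat_eq_mat2 D_eq field_simps power2_eq_square\<close>)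
    moreover have "C ** map_mat f Y\<^sub>0 ** adj C \<propto> Y\<^sub>0"
      unfolding map_f f\<xi> C_def unfolding Y\<^sub>0_def by (rule peqI[of "\<epsilon>"])
        (use \<epsilon> nz in \<open>auto simp: mat_eq_mat2 D_eq field_simps power2_eq_square\<close>)
    moreover have "C ** map_mat f Z\<^sub>0 ** adj C \<propto> Z\<^sub>0"
      unfolding map_f f\<xi> C_def unfolding Z\<^sub>0_def by (rule peqI[of "1"])
        (use \<epsilon> nz in \<open>auto simp: mat_eq_mat2 D_eq field_simps power2_eq_square\<close>)
    ultimately show ?thesis by blast
  next
    case (2 \<epsilon>)
    have f\<xi>: "f \<xi> = \<epsilon> * inverse \<xi>" using 2 by (simp add: f_def)
    have \<epsilon>: "\<epsilon> = 1 \<or> \<epsilon> = - 1" using 2 by (simp add: square_eq_1_iff)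
    \<comment> \<open>With lower left entry 1, preserving Z requires the upper right entry to square
      to \<open>(\<omega> * v)\<^sup>2\<close>; the image of X forces the sign
      \<open>\<epsilon>\<close>.\<close>
    define C where "C = mat2 0 (\<epsilon> * \<omega> * v) 1 0"
    have "det C \<noteq> 0" using \<epsilon> nz by (auto simp: C_def)
    moreover have "C ** map_mat f X\<^sub>0 ** adj C \<propto> X\<^sub>0 ** Y\<^sub>0"
      unfolding map_f f\<xi> C_def unfolding products(1) by (rule peqI[of "\<epsilon> * \<omega> * \<omega> / v"])
        (use \<epsilon> nz in \<open>auto simp: mat_eq_mat2 D_eq field_simps power2_eq_square\<close>)
    moreover have "C ** map_mat f Y\<^sub>0 ** adj C \<propto> Y\<^sub>0"
      unfolding map_f f\<xi> C_def unfolding Y\<^sub>0_def by (rule peqI[of "\<epsilon> * \<omega> * \<omega>"])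
        (use \<epsilon> nz in \<open>auto simp: mat_eq_mat2 D_eq field_simps power2_eq_square\<close>)
    moreover have "C ** map_mat f Z\<^sub>0 ** adj C \<propto> Z\<^sub>0"
      unfolding map_f f\<xi> C_def unfolding Z\<^sub>0_def by (rule peqI[of "\<omega> * \<omega>"])
        (use \<epsilon> nz in \<open>auto simp: mat_eq_mat2 D_eq field_simps power2_eq_square\<close>)
    ultimately show ?thesis by blast
  qed
  then obtain C where C: "det C \<noteq> 0" "C ** map_mat f X\<^sub>0 ** adj C \<propto> X\<^sub>0 ** Y\<^sub>0"
    "C ** map_mat f Y\<^sub>0 ** adj C \<propto> Y\<^sub>0" "C ** map_mat f Z\<^sub>0 ** adj C \<propto> Z\<^sub>0" by blast
  obtain \<Phi> where \<Phi>: "\<Phi> \<in> hom P P" and "\<forall>A. \<Phi> (proj A) = proj (C ** map_mat f A ** adj C)"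
    using exists_semilinear_hom[of f, OF f_mult f_add f_eq_0 C(1)] by blast
  then have \<Phi>_XYZ: "\<Phi> X = X \<otimes>\<^bsub>P\<^esub> Y" "\<Phi> Y = Y" "\<Phi> Z = Z"
    using C by (simp_all add: proj_eq_iff proj_products)
  have YY: "X \<otimes>\<^bsub>P\<^esub> Y \<otimes>\<^bsub>P\<^esub> Y = X"
  proof -
    have "X\<^sub>0 ** Y\<^sub>0 ** Y\<^sub>0 = mat D ** X\<^sub>0"
      by (simp add: products(5) mat_mult_commute flip: matrix_mul_assoc)
    then show ?thesis
      using det_nz D_nz by (simp add: proj_products proj_mult det_mul)
  qed
  have \<Phi>_XY: "\<Phi> (X \<otimes>\<^bsub>P\<^esub> Y) = X"
    using hom_mult[OF \<Phi>, of X Y] XYZ_carrier \<Phi>_XYZ YY by simp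
  have XYZ_G: "{X, Y, Z} \<subseteq> carrier G"
    by (rule P.subgroup_generated_subset_carrier_subset[OF XYZ_carrier])
  then have "X \<otimes>\<^bsub>P\<^esub> Y \<in> carrier G"
    using subgroup.m_closed[OF P.subgroup_subgroup_generated] by auto
  then have "\<Phi> \<in> iso G G \<and> (\<forall>x\<in>carrier G. \<Phi> (\<Phi> x) = x)"
    using XYZ_G \<Phi>_XYZ \<Phi>_XY
    by (intro P.involutive_automorphism_subgroup_generated \<Phi> XYZ_carrier) auto
  then show ?thesis
    unfolding self_Petrie_dual_def using \<Phi>_XYZ \<Phi>_XY by (intro bexI[of _ \<Phi>]) auto
qed

end

section \<open>The criterion for self-Petrie-duality\<close>

theorem theorem4p2:
  fixes p e q k l :: nat
    and \<xi>\<^sub>k \<xi>\<^sub>l \<omega>\<^sub>k \<omega>\<^sub>l D s \<beta> \<eta> :: "'a :: alg_closed_field"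
    and X Y Z :: "('a ^ 2 ^ 2) set"
    and G :: "('a ^ 2 ^ 2) set monoid"
  assumes "prime p" and "odd p" and "e \<ge> 1" and "q = p ^ e"
    and "algebraic_closure_GF TYPE('a) p"
    and "k \<ge> 3" and "l \<ge> 3" and "coprime k p" and "coprime l p"
    and "1 / real k + 1 / real l < 1 / 2"
    and "primitive_root_of_unity (2 * k) \<xi>\<^sub>k" and "\<xi>\<^sub>k \<in> GF q \<union> GF (q ^ 2)"
    and "primitive_root_of_unity (2 * l) \<xi>\<^sub>l" and "\<xi>\<^sub>l \<in> GF q \<union> GF (q ^ 2)"
    and "\<omega>\<^sub>k = \<xi>\<^sub>k + inverse \<xi>\<^sub>k" and "\<omega>\<^sub>l = \<xi>\<^sub>l + inverse \<xi>\<^sub>l"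
    and "D = \<omega>\<^sub>k\<^sup>2 + \<omega>\<^sub>l\<^sup>2 - 4" and "D \<noteq> 0"
    and "s\<^sup>2 = - D" and "\<beta> = - 1 / s"
    and "\<eta> = inverse (\<xi>\<^sub>k - inverse \<xi>\<^sub>k)"
    and "X = proj (mat (\<eta> * \<beta>) ** mat2 D (D * \<omega>\<^sub>l * \<xi>\<^sub>k) (- \<omega>\<^sub>l * inverse \<xi>\<^sub>k) (- D))"
    and "Y = proj (mat \<beta> ** mat2 0 (\<xi>\<^sub>k * D) (inverse \<xi>\<^sub>k) 0)"
    and "Z = proj (mat \<beta> ** mat2 0 D 1 0)"
    and "G = subgroup_generated (PGL2 UNIV) {X, Y, Z}"
    and "G \<cong> PSL2 (GF q :: 'a set) \<or> G \<cong> PGL2 (GF q :: 'a set)"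
  shows "regular_map k l G X Y Z \<and>
    (self_Petrie_dual G X Y Z \<longleftrightarrow>
       \<omega>\<^sub>l\<^sup>2 = - D \<or>
       (\<exists>j r. j > 0 \<and> r = p ^ j \<and> q = r\<^sup>2 \<and> q = p ^ (2 * j) \<and>
              \<omega>\<^sub>l ^ (2 * r) = - D \<and> (k dvd r + 1 \<or> k dvd r - 1)))"
proof -
  have char: "CHAR('a) = p" using assms(5) by (simp add: algebraic_closure_GF_def)
  define F where "F = (GF q :: 'a set)"
  interpret Galois_field p e q F
    by unfold_locales (use assms(1-4) char in \<open>simp_all add: F_def\<close>)
  have two: "(2 :: 'a) \<noteq> 0"
    using assms(1,2) unfolding char[symmetric] by (rule two_neq_0_if_odd_char)
  define \<delta> where "\<delta> = \<xi>\<^sub>k - inverse \<xi>\<^sub>k"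
  have \<xi>_nz: "\<xi>\<^sub>k \<noteq> 0"
    using assms(11) by (auto simp: primitive_root_of_unity_def power_0_left split: if_splits)
  have D: "D = \<delta>\<^sup>2 + \<omega>\<^sub>l\<^sup>2"
    using \<xi>_nz by (simp add: assms(15,17) \<delta>_def power2_eq_square algebra_simps)
  interpret T: generating_triple k l \<xi>\<^sub>k \<xi>\<^sub>l \<delta> \<omega>\<^sub>l D
    using assms two D \<delta>_def by unfold_locales blast+
  have \<beta>: "\<beta> \<noteq> 0" using assms(18,19,20) by auto
  have \<eta>: "\<eta> \<noteq> 0" using T.\<delta>_nz by (simp add: assms(21) \<delta>_def)
  have X: "X = T.X" and Y: "Y = T.Y" and Z: "Z = T.Z"
    using \<beta> \<eta> by (simp_all add: assms(22-24) T.X\<^sub>0_def T.Y\<^sub>0_def T.Z\<^sub>0_def)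
  interpret P: group "PGL2 (UNIV :: 'a set)" by (rule group_PGL2_UNIV)
  have G: "G = T.G" by (simp only: assms(25) X Y Z)
  have G_facts: "group G" "carrier G \<subseteq> carrier (PGL2 UNIV)" "mult G = mult (PGL2 UNIV)"
      "one G = one (PGL2 UNIV)"
    unfolding assms(25) by (simp_all add: P.carrier_subgroup_generated_subset)
  have iso: "G \<cong> PSL2 F \<or> G \<cong> PGL2 F" unfolding F_def by (rule assms(26))
  note aut = automorphism_class_\<tau>[OF G_facts iso]
  interpret G: group G by (rule G_facts)
  have XYZ: "X \<in> carrier G" "Y \<in> carrier G" "Z \<in> carrier G"
    using P.subgroup_generated_subset_carrier_subset[OF T.XYZ_carrier] unfolding G X Y Z by auto
  have mult_G: "g \<otimes>\<^bsub>G\<^esub> h = g \<otimes>\<^bsub>T.P\<^esub> h" for g h by (simp add: G_facts(3))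
  have \<tau>s: "class_\<tau> (Y \<otimes>\<^bsub>G\<^esub> Z) = \<omega>\<^sub>k\<^sup>2" "class_\<tau> (Z \<otimes>\<^bsub>G\<^esub> X) = \<omega>\<^sub>l\<^sup>2"
    "class_\<tau> (Z \<otimes>\<^bsub>G\<^esub> (X \<otimes>\<^bsub>G\<^esub> Y)) = - D"
    unfolding mult_G X Y Z T.proj_products(4) unfolding T.proj_products class_\<tau>_proj T.\<tau>_products assms(15)
    by simp_all
  have dream: "(x + y) ^ (p ^ j) = x ^ (p ^ j) + y ^ (p ^ j)" for x y :: 'a and j
    by (rule freshmans_dream') (simp_all add: char assms(1))
  have p_pow: "p ^ j > 0" "odd (p ^ j)" for j using assms(1,2) by (simp_all add: prime_gt_0_nat)
  have "self_Petrie_dual G X Y Z \<longleftrightarrow>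
       \<omega>\<^sub>l\<^sup>2 = - D \<or>
       (\<exists>j r. j > 0 \<and> r = p ^ j \<and> q = r\<^sup>2 \<and> q = p ^ (2 * j) \<and>
              \<omega>\<^sub>l ^ (2 * r) = - D \<and> (k dvd r + 1 \<or> k dvd r - 1))" (is "_ \<longleftrightarrow> ?A \<or> ?B")
  proof
    assume "self_Petrie_dual G X Y Z"
    then obtain \<phi> where \<phi>: "\<phi> \<in> iso G G" "\<forall>g\<in>carrier G. \<phi> (\<phi> g) = g"
      "\<phi> Y = Y" "\<phi> Z = Z" "\<phi> X = X \<otimes>\<^bsub>G\<^esub> Y"
      unfolding self_Petrie_dual_def by blast
    obtain j where j: "j = 0 \<or> 2 * j = e"
      "\<And>g. g \<in> carrier G \<Longrightarrow> class_\<tau> (\<phi> g) = class_\<tau> g ^ (p ^ j)"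
      using aut[OF \<phi>(1)] \<phi>(2) by blast
    have hom: "\<phi> (g \<otimes>\<^bsub>G\<^esub> h) = \<phi> g \<otimes>\<^bsub>G\<^esub> \<phi> h" if "g \<in> carrier G" "h \<in> carrier G" for g h
      using \<phi>(1) that by (auto simp: iso_def hom_mult)
    have "\<phi> (Z \<otimes>\<^bsub>G\<^esub> X) = Z \<otimes>\<^bsub>G\<^esub> (X \<otimes>\<^bsub>G\<^esub> Y)"
      by (simp only: hom[OF XYZ(3,1)] \<phi>)
    then have ZX: "- D = (\<omega>\<^sub>l\<^sup>2) ^ (p ^ j)"
      using j(2)[OF G.m_closed[OF XYZ(3,1)]] by (simp only: \<tau>s)
    have "\<phi> (Y \<otimes>\<^bsub>G\<^esub> Z) = Y \<otimes>\<^bsub>G\<^esub> Z"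
      by (simp only: hom[OF XYZ(2,3)] \<phi>)
    then have YZ: "(\<omega>\<^sub>k\<^sup>2) ^ (p ^ j) = \<omega>\<^sub>k\<^sup>2"
      using j(2)[OF G.m_closed[OF XYZ(2,3)]] by (simp only: \<tau>s)
    show "?A \<or> ?B"
    proof (cases "j = 0")
      case True
      then show ?thesis using ZX by simp
    next
      case False
      then have e: "e = 2 * j" using j(1) by simp
      have "k dvd p ^ j + 1 \<or> k dvd p ^ j - 1"
        using T.divides_if_trace_fixed[OF p_pow(1) dream] YZ by (simp only: assms(15))
      moreover have "q = (p ^ j)\<^sup>2" "q = p ^ (2 * j)" by (simp_all add: assms(4) e power_even_eq)
      moreover have "\<omega>\<^sub>l ^ (2 * p ^ j) = - D" unfolding ZX by (rule power_mult)
      ultimately show ?thesis using False by blast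
    qed
  next
    assume "?A \<or> ?B"
    then show "self_Petrie_dual G X Y Z"
    proof
      \<comment> \<open>The first condition is the case r = 1, where the field automorphism is the
        identity and \<open>k\<close> divides r - 1 = 0.\<close>
      assume "?A"
      then show ?thesis
        unfolding G X Y Z by (intro T.self_Petrie_dual_if[of 1]) auto
    next
      assume ?B
      then obtain j r where j: "r = p ^ j" "q = r\<^sup>2" "\<omega>\<^sub>l ^ (2 * r) = - D" "k dvd r + 1 \<or> k dvd r - 1"
        by blast
      \<comment> \<open>The identity automorphism is used only to learn that
        \<open>\<omega>\<^sub>l\<^sup>2\<close> lies in \<open>F\<close>. There the q-th power is
        trivial, so raising \<open>\<omega>\<^sub>l ^ (2 * r) = - D\<close> to the r-th power gives
        the companion equation for \<open>D ^ r\<close>.\<close>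
      have "class_\<tau> (Z \<otimes>\<^bsub>G\<^esub> X) \<in> F"
        using aut[OF iso_set_refl] G.m_closed[OF XYZ(3,1)] by blast
      then have "(\<omega>\<^sub>l\<^sup>2) ^ q = \<omega>\<^sub>l\<^sup>2" by (simp only: \<tau>s F_eq mem_Collect_eq)
      also have "(\<omega>\<^sub>l\<^sup>2) ^ q = ((\<omega>\<^sub>l\<^sup>2) ^ r) ^ r"
        unfolding j(2) power2_eq_square[of r] by (rule power_mult)
      also have "(\<omega>\<^sub>l\<^sup>2) ^ r = - D" unfolding j(3)[symmetric] by (rule power_mult[symmetric])
      finally have "(- D) ^ r = \<omega>\<^sub>l\<^sup>2" .
      then have "- (D ^ r) = \<omega>\<^sub>l\<^sup>2" using p_pow(2)[of j] j(1) by simp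
      then have "D ^ r = - \<omega>\<^sub>l\<^sup>2" by (metis minus_minus)
      then show ?thesis
        unfolding G X Y Z using j p_pow dream by (intro T.self_Petrie_dual_if[of r]) auto
    qed
  qed
  then show ?thesis using T.regular_map unfolding G X Y Z by blast
qed

end
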